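(* Let $P$ and $Q$ be two finite posets on $[d]$. Then $$h^*(\mathcal{C}_{P,Q}, x) = \frac{1}{2^{d}}\sum_{\varepsilon \in \{-1,1\}^d} h^*(\mathcal{C}^{(e)}_{R_{\varepsilon}},x)=(x+1)^d f_{P,Q}\left( \frac{4x}{(x+1)^2} \right),\quad\text{where } f_{P,Q}(x)=\frac{1}{2^{d}}\sum_{\varepsilon \in \{-1,1\}^d} W^{(\ell)}_{R_{\varepsilon}}(x),$$ $I_{\varepsilon}=\{i \in [d] : \varepsilon_i=1 \}$, and $R_{\varepsilon}$ is a naturally labeled poset on $[d]$ obtained from $P_{I_\varepsilon} \oplus Q_{\overline{I_{\varepsilon}}}$ by relabeling. In particular, $h^*(\mathcal{C}_{P,Q},x)$ is $\gamma$-positive. Moreover, $h^*(\mathcal{C}_{P,Q},x)$ is real-rooted if and only if $f_{P,Q}(x)$ is real-rooted.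
   Context: For a finite poset $P$ on $[d]$, $\mathcal{C}_P=\mathrm{conv}\{\mathbf{e}_A:A\text{ an antichain of }P\}$ with $\mathbf{e}_A=\sum_{i\in A}\mathbf{e}_i$; the enriched chain polytope is $\mathcal{C}^{(e)}_P=\{(\varepsilon_1x_1,\dots,\varepsilon_dx_d):\varepsilon\in\{-1,1\}^d,\mathbf{x}\in\mathcal{C}_P\}$; the twinned chain polytope is $\mathcal{C}_{P,Q}=\mathrm{conv}(\mathcal{C}_P\cup(-\mathcal{C}_Q))$. For $I\subset[d]$, $P_I$ is the induced subposet on $I$ and $\overline{I}=[d]\setminus I$. For disjoint posets $P,Q$, the ordinal sum $P\oplus Q$ is the poset on $P\cup Q$ with $i<j$ iff $i<_Pj$, or $i<_Qj$, or $i\in P$ and $j\in Q$. A poset on $[d]$ is naturally labeled if $i<j$ in the poset implies $i<j$ as integers. For a naturally labeled poset $R$ on $[d]$, a linear extension is an ordering $\pi=(\pi_1,\dots,\pi_d)$ of $[d]$ such that $\pi_a<_R\pi_b$ implies $a<b$; a left peak of $\pi$ is an index $1\le i\le d-1$ with $\pi_{i-1}<\pi_i>\pi_{i+1}$, where $\pi_0=0$; $\mathrm{pk}^{(\ell)}(\pi)$ is the number of left peaks, and $W^{(\ell)}_R(x)=\sum_{\pi}x^{\mathrm{pk}^{(\ell)}(\pi)}$ over all linear extensions. The $h^*$-polynomial of a $d$-dimensional lattice polytope $\mathcal{P}\subset\mathbb{R}^d$ is defined by $1+\sum_{m\ge1}|m\mathcal{P}\cap\mathbb{Z}^d|x^m=h^*(\mathcal{P},x)/(1-x)^{d+1}$.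 A degree-$d$ polynomial $f$ is $\gamma$-positive if $f(x)=x^df(1/x)$ and $f=\sum_i\gamma_ix^i(1+x)^{d-2i}$ with $\gamma_i\ge0$. *)

theory Defs
  imports
    "HOL-Analysis.Analysis"
    "HOL-Computational_Algebra.Polynomial_FPS"
    "HOL-Combinatorics.Multiset_Permutations"
begin

text \<open>
  The index set \<open>[d]\<close> is modelled by a type \<open>'n\<close> of classes \<open>finite\<close> and \<open>linorder\<close>; such a type
  is order-isomorphic to \<open>{1..d}\<close> for \<open>d = CARD('n)\<close>, and \<open>\<real>\<^sup>d\<close> is \<open>real ^ 'n\<close>. Its linear order is
  the order of the labels, used only for natural labelings and left peaks. A poset on \<open>[d]\<close> is a
  reflexive partial order \<open>P\<close> with \<open>partial_order_on UNIV P\<close>; so \<open>i <\<^sub>P j\<close> is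
  \<open>(i, j) \<in> P \<and> i \<noteq> j\<close>, and the induced subposet \<open>P\<^sub>I\<close> is \<open>Restr P I\<close>.
\<close>

section \<open>Posets\<close>

definition antichain :: "'a rel \<Rightarrow> 'a set \<Rightarrow> bool" where
  "antichain P A \<longleftrightarrow> (\<forall>i\<in>A. \<forall>j\<in>A. (i, j) \<in> P \<longrightarrow> i = j)"

text \<open>For reflexive relations, \<^const>\<open>Field\<close> is the underlying set of the poset.\<close>

definition ordinal_sum :: "'a rel \<Rightarrow> 'a rel \<Rightarrow> 'a rel" (infixl "\<oplus>\<^sub>o" 65) where
  "P \<oplus>\<^sub>o Q = P \<union> Q \<union> Field P \<times> Field Q"

definition naturally_labeled :: "('a::linorder) rel \<Rightarrow> bool" where
  "naturally_labeled R \<longleftrightarrow> (\<forall>i j. (i, j) \<in> R \<and> i \<noteq> j \<longrightarrow> i < j)"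

definition relabeling_of :: "'a rel \<Rightarrow> 'a rel \<Rightarrow> bool" where
  "relabeling_of S R \<longleftrightarrow> (\<exists>\<sigma>. bij \<sigma> \<and> R = map_prod \<sigma> \<sigma> ` S)"

section \<open>Chain polytopes\<close>

definition indicator_vec :: "'n set \<Rightarrow> real ^ 'n::finite" where
  "indicator_vec A = (\<Sum>i\<in>A. axis i 1)"

definition chain_polytope :: "'n rel \<Rightarrow> (real ^ 'n::finite) set" where
  "chain_polytope P = convex hull {indicator_vec A | A. antichain P A}"

definition sign_vectors :: "(real ^ 'n::finite) set" where
  "sign_vectors = {\<epsilon>. \<forall>i. \<epsilon> $ i \<in> {-1, 1}}"

definition enriched_chain_polytope :: "'n rel \<Rightarrow> (real ^ 'n::finite) set" where
  "enriched_chain_polytope P =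
     {(\<chi> i. \<epsilon> $ i * x $ i) | \<epsilon> x. \<epsilon> \<in> sign_vectors \<and> x \<in> chain_polytope P}"

definition twinned_chain_polytope :: "'n rel \<Rightarrow> 'n rel \<Rightarrow> (real ^ 'n::finite) set" where
  "twinned_chain_polytope P Q = convex hull (chain_polytope P \<union> uminus ` chain_polytope Q)"

definition sign_poset :: "'n rel \<Rightarrow> 'n rel \<Rightarrow> real ^ 'n::finite \<Rightarrow> 'n rel" where
  "sign_poset P Q \<epsilon> = (let I = {i. \<epsilon> $ i = 1} in Restr P I \<oplus>\<^sub>o Restr Q (- I))"

section \<open>The \<open>h*\<close>-polynomial\<close>

definition lattice_points :: "(real ^ 'n::finite) set" where
  "lattice_points = {x. \<forall>i. x $ i \<in> \<int>}"

definition ehrhart_series :: "(real ^ 'n::finite) set \<Rightarrow> real fps" where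
  "ehrhart_series S =
     Abs_fps (\<lambda>m. if m = 0 then 1 else of_nat (card ((\<lambda>x. real m *\<^sub>R x) ` S \<inter> lattice_points)))"

text \<open>
  Meant for full-dimensional lattice polytopes only: the exponent is \<open>d + 1\<close> with \<open>d = CARD('n)\<close>.
\<close>

definition hstar :: "(real ^ 'n::finite) set \<Rightarrow> real poly" where
  "hstar S = (THE h. fps_of_poly h = ehrhart_series S * (1 - fps_X) ^ (CARD('n) + 1))"

section \<open>Left peak polynomials\<close>

definition linear_extensions :: "('n::finite) rel \<Rightarrow> 'n list set" where
  "linear_extensions R =
     {\<pi> \<in> permutations_of_set UNIV.
        \<forall>a b. a < length \<pi> \<and> b < length \<pi> \<and> (\<pi> ! a, \<pi> ! b) \<in> R \<and> \<pi> ! a \<noteq> \<pi> ! b \<longrightarrow> a < b}"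

text \<open>
  List positions start at \<open>0\<close>, so position \<open>i\<close> holds \<open>\<pi>\<^sub>i\<^sub>+\<^sub>1\<close>. The convention \<open>\<pi>\<^sub>0 = 0\<close> puts the
  initial sentinel below every label, whence the disjunct \<open>i = 0\<close>.
\<close>

definition left_peaks :: "('a::linorder) list \<Rightarrow> nat" where
  "left_peaks \<pi> =
     card {i. i + 1 < length \<pi> \<and> (i = 0 \<or> \<pi> ! (i - 1) < \<pi> ! i) \<and> \<pi> ! i > \<pi> ! (i + 1)}"

definition left_peak_poly :: "('n::{finite,linorder}) rel \<Rightarrow> real poly" where
  "left_peak_poly R = (\<Sum>\<pi>\<in>linear_extensions R. monom 1 (left_peaks \<pi>))"

section \<open>Properties of polynomials\<close>

text \<open>\<^term>\<open>reflect_poly f\<close> is \<open>x\<^sup>d f(1/x)\<close> for \<open>d = degree f\<close>.\<close>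

definition gamma_positive :: "real poly \<Rightarrow> bool" where
  "gamma_positive f \<longleftrightarrow> reflect_poly f = f \<and>
     (\<exists>\<gamma>. (\<forall>i. \<gamma> i \<ge> 0) \<and>
        f = (\<Sum>i\<le>degree f div 2. monom (\<gamma> i) i * [:1, 1:] ^ (degree f - 2 * i)))"

definition real_rooted :: "real poly \<Rightarrow> bool" where
  "real_rooted f \<longleftrightarrow> (\<forall>z::complex. poly (map_poly complex_of_real f) z = 0 \<longrightarrow> z \<in> \<real>)"

section \<open>Existence of natural relabelings\<close>

lemma ex_order_preserving_bij:
  fixes S :: "'a rel" and A :: "'a set" and T :: "('b::linorder) set"
  assumes "finite A" "finite T" "card A = card T" "trans S" "antisym S"
  shows "\<exists>\<sigma>. bij_betw \<sigma> A T \<and> (\<forall>x\<in>A. \<forall>y\<in>A. (x, y) \<in> S \<and> x \<noteq> y \<longrightarrow> \<sigma> x < \<sigma> y)"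
  using assms(1-3)
proof (induction "card A" arbitrary: A T)
  case 0
  then show ?case by (auto simp: bij_betw_def)
next
  case (Suc n)
  have "acyclic (S - Id)"
    using assms(4,5) by (simp add: acyclic_irrefl trans_diff_Id)
  then have "acyclic ((S - Id) \<inter> A \<times> A)"
    by (rule acyclic_subset) blast
  then have "wf (((S - Id) \<inter> A \<times> A)\<inverse>)"
    using Suc.prems(1) by (intro finite_acyclic_wf_converse) auto
  moreover obtain b where "b \<in> A" using Suc.hyps(2) by fastforce
  ultimately obtain a where a: "a \<in> A"
    and "\<And>y. (y, a) \<in> ((S - Id) \<inter> A \<times> A)\<inverse> \<Longrightarrow> y \<notin> A"
    by (rule wfE_min) blast
  then have a_max: "y = a" if "y \<in> A" "(a, y) \<in> S" for y
    using that by blast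
  have T: "T \<noteq> {}" using Suc by auto
  define t where "t = Max T"
  have t: "t \<in> T" "\<And>u. u \<in> T - {t} \<Longrightarrow> u < t"
    using T Suc.prems(2) by (auto simp: t_def order_less_le)
  have "n = card (A - {a})" "card (A - {a}) = card (T - {t})"
    using Suc a(1) t(1) by auto
  then obtain \<sigma> where \<sigma>: "bij_betw \<sigma> (A - {a}) (T - {t})"
    "\<forall>x\<in>A - {a}. \<forall>y\<in>A - {a}. (x, y) \<in> S \<and> x \<noteq> y \<longrightarrow> \<sigma> x < \<sigma> y"
    using Suc.hyps(1)[of "A - {a}" "T - {t}"] Suc.prems by auto
  have "bij_betw (\<sigma>(a := t)) (A - {a}) (T - {t})"
    using \<sigma>(1) by (subst bij_betw_cong[of _ _ \<sigma>]) auto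
  moreover have "bij_betw (\<sigma>(a := t)) {a} {t}"
    by simp
  ultimately have "bij_betw (\<sigma>(a := t)) ((A - {a}) \<union> {a}) ((T - {t}) \<union> {t})"
    by (rule bij_betw_combine) blast
  then have "bij_betw (\<sigma>(a := t)) A T"
    using a(1) t(1) by (simp add: insert_absorb)
  moreover have "(\<sigma>(a := t)) x < (\<sigma>(a := t)) y"
    if "x \<in> A" "y \<in> A" "(x, y) \<in> S" "x \<noteq> y" for x y
  proof -
    have "x \<noteq> a" using a_max that by blast
    show ?thesis
    proof (cases "y = a")
      case True
      have "\<sigma> x \<in> T - {t}" using \<sigma>(1) that(1) \<open>x \<noteq> a\<close> by (auto dest: bij_betwE)
      then show ?thesis using t(2) True \<open>x \<noteq> a\<close> by simp
    next
      case False
      then show ?thesis using \<sigma>(2) that \<open>x \<noteq> a\<close> by simp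
    qed
  qed
  ultimately show ?case by blast
qed

lemma partial_order_on_sign_poset:
  assumes "partial_order_on UNIV P" "partial_order_on UNIV Q"
  shows "partial_order_on UNIV (sign_poset P Q \<epsilon>)"
proof -
  have refl: "(x, x) \<in> P" "(x, x) \<in> Q" for x
    using assms by (auto simp: order_on_defs refl_on_def)
  then have "Field (Restr P I) = I" "Field (Restr Q I) = I" for I
    by (fastforce simp: Field_def)+
  then have *: "(x, y) \<in> sign_poset P Q \<epsilon> \<longleftrightarrow>
      (if \<epsilon> $ x = 1 then \<epsilon> $ y = 1 \<longrightarrow> (x, y) \<in> P else \<epsilon> $ y \<noteq> 1 \<and> (x, y) \<in> Q)" for x y
    by (auto simp: sign_poset_def ordinal_sum_def Let_def)
  have "trans P" "trans Q" "antisym P" "antisym Q"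
    using assms by (auto simp: order_on_defs)
  then have "trans (sign_poset P Q \<epsilon>)" "antisym (sign_poset P Q \<epsilon>)"
    by (auto intro!: transI antisymI simp: * split: if_splits dest: transD antisymD)
  then show ?thesis
    using refl by (auto simp: order_on_defs refl_on_def *)
qed

lemma ex_natural_relabeling:
  fixes S :: "('n::{finite,linorder}) rel"
  assumes "partial_order_on UNIV S"
  shows "\<exists>R. relabeling_of S R \<and> naturally_labeled R"
proof -
  obtain \<sigma> :: "'n \<Rightarrow> 'n" where \<sigma>: "bij \<sigma>" "\<forall>x y. (x, y) \<in> S \<and> x \<noteq> y \<longrightarrow> \<sigma> x < \<sigma> y"
    using ex_order_preserving_bij[of "UNIV :: 'n set" "UNIV :: 'n set" S] assms
    by (auto simp: order_on_defs)
  then show ?thesis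
    by (intro exI[of _ "map_prod \<sigma> \<sigma> ` S"]) (auto simp: relabeling_of_def naturally_labeled_def)
qed

end

theory Submission
  imports Defs
begin

text \<open>
  A lattice point of \<open>m \<C>\<^sub>P\<^sub>,\<^sub>Q\<close> with signs \<open>\<epsilon>\<close> is, up to these signs, a lattice point of the chain
  polytope \<open>m \<C>\<^sub>R\<close> of \<open>R = R\<^sub>\<epsilon>\<close>: antichains of an ordinal sum lie in one of the summands,
  and maximal chain sums add up. Exchanging \<open>\<epsilon>\<close> with the signs of a point of the enriched polytope
  is an involution that yields \<open>2\<^sup>d\<close> times the Ehrhart series of \<open>\<C>\<^sub>P\<^sub>,\<^sub>Q\<close> as a sum over \<open>\<epsilon>\<close>.
  Lattice points of enriched chain polytopes correspond, by Stanley's transfer map, to left enriched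
  \<open>P\<close>-partitions. Sorting these decomposes them over linear extensions, and a two-state recursion on
  the last letter evaluates the generating function of each piece in terms of left peaks.
\<close>

section \<open>Words compatible with a permutation\<close>

text \<open>A lattice point with zero coordinates lies in several closed orthants, so orthant counts
  do not simply add up. The involution avoids inclusion-exclusion: on both sides every point carries
  a full sign vector, so each lattice point of the twinned polytope is counted exactly 2^d times.
  Chains are never enumerated. A height function certifies the bound on all chain sums; certificates
  can be added and scaled, which yields convexity, and the least one comes from well-founded
  recursion. The substitution 4x/(x+1)^2 is a quotient of two transfer factors. Appending a letter
  to a permutation multiplies its generating function by (1+x)/(1-x), unless the letter completes a
  left peak, when the factor is 4x/((1-x)(1+x)). With k left peaks and length d this gives (4x)^k
  (1+x)^(d-2k) / (1-x)^(d+1); the extra 1/(1-x) belongs to the empty word.\<close>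

text \<open>
  The value \<open>2k\<close> encodes \<open>k\<close> and \<open>2k - 1\<close> encodes \<open>-k\<close>, for the order \<open>0 < -1 < 1 < -2 < 2 < \<dots>\<close>.
\<close>
definition label_order :: "'a::linorder \<times> nat \<Rightarrow> 'a \<times> nat \<Rightarrow> bool" where
  "label_order p q \<longleftrightarrow> snd p < snd q \<or>
     snd p = snd q \<and> (if even (snd p) then fst p < fst q else fst q < fst p)"

definition sorted_words :: "'a::linorder list \<Rightarrow> nat \<Rightarrow> nat list set" where
  "sorted_words xs N =
     {us. length us = length xs \<and> set us \<subseteq> {..<N} \<and> successively label_order (zip xs us)}"

lemma finite_sorted_words: "finite (sorted_words xs N)"
proof -
  have "finite {us. set us \<subseteq> {..<N} \<and> length us = length xs}"
    by (rule finite_lists_length_eq) simp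
  then show ?thesis
    by (rule finite_subset[rotated]) (auto simp: sorted_words_def)
qed

lemma transp_label_order: "transp label_order"
  by (auto simp: transp_def label_order_def split: if_splits)

text \<open>Values never decrease along \<open>label_order\<close>, and the relation is transitive.
  Hence a range condition on a word reduces to one on its last value.\<close>

lemma successively_zip_bound:
  fixes a :: "'a::linorder"
  assumes "length us = length xs" "successively label_order (zip (xs @ [a]) (us @ [v]))" "u \<in> set us"
  shows "u \<le> v"
proof -
  have "sorted_wrt label_order (zip (xs @ [a]) (us @ [v]))"
    using assms(2) by (simp add: successively_conv_sorted_wrt[OF transp_label_order])
  then have "\<forall>p\<in>set (zip xs us). label_order p (a, v)"
    using assms(1) by (simp add: sorted_wrt_append)
  moreover obtain x where "(x, u) \<in> set (zip xs us)"
    using assms(1,3) by (metis in_set_impl_in_set_zip2)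
  ultimately show ?thesis by (auto simp: label_order_def)
qed

lemma card_sorted_words_singleton: "card (sorted_words [a] N) = N"
proof -
  have "sorted_words [a] N = (\<lambda>v. [v]) ` {..<N}"
    by (auto simp: sorted_words_def length_Suc_conv)
  then show ?thesis by (simp add: card_image inj_on_def)
qed

lemma sorted_words_0: "xs \<noteq> [] \<Longrightarrow> sorted_words xs 0 = {}"
  by (auto simp: sorted_words_def)

text \<open>Either the last value is below \<open>N\<close>, and the word obeys the bound
  \<open>N\<close>, or it equals \<open>N\<close>. Then the rest may itself end in \<open>N\<close>
  exactly if the tie rule puts \<open>a\<close> before \<open>b\<close>: upwards for even
  \<open>N\<close>, downwards for odd \<open>N\<close>.\<close>

lemma card_sorted_words_Suc:
  assumes "a \<noteq> b"
  shows "card (sorted_words (xs @ [a, b]) (Suc N)) =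
    card (sorted_words (xs @ [a, b]) N) +
    card (sorted_words (xs @ [a]) (if even N \<longleftrightarrow> a < b then Suc N else N))"
proof -
  let ?M = "if even N \<longleftrightarrow> a < b then Suc N else N"
  let ?T = "(\<lambda>us. us @ [N]) ` sorted_words (xs @ [a]) ?M"
  have sub: "us @ [N] \<in> sorted_words (xs @ [a, b]) (Suc N) \<longleftrightarrow> us \<in> sorted_words (xs @ [a]) ?M" for us
  proof (cases "length us = Suc (length xs)")
    case True
    then obtain vs v where us: "us = vs @ [v]" "length vs = length xs"
      by (metis length_Suc_conv_rev)
    have z: "zip (xs @ [a]) us = zip xs vs @ [(a, v)]"
      and z': "zip (xs @ [a, b]) (us @ [N]) = zip xs vs @ [(a, v), (b, N)]"
      using us by simp_all
    have le: "w \<le> v" if "successively label_order (zip xs vs @ [(a, v)])" "w \<in> set vs" for w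
      using successively_zip_bound[OF us(2) _ that(2), of a v] that(1) us(2) by simp
    have "successively label_order (zip xs vs @ [(a, v), (b, N)]) \<longleftrightarrow>
      successively label_order (zip xs vs @ [(a, v)]) \<and> label_order (a, v) (b, N)"
      by (auto simp: successively_append_iff)
    moreover have "label_order (a, v) (b, N) \<longleftrightarrow> v < ?M"
      using assms by (auto simp: label_order_def less_Suc_eq)
    ultimately show ?thesis
      unfolding sorted_words_def mem_Collect_eq z z' using us le
      by (auto simp: less_Suc_eq_le intro: le_less_trans order_trans split: if_splits)
  qed (auto simp: sorted_words_def)
  have "us \<in> ?T" if "us \<in> sorted_words (xs @ [a, b]) (Suc N)" "us \<notin> sorted_words (xs @ [a, b]) N" for us
  proof -
    have "length us = Suc (Suc (length xs))" using that(1) by (simp add: sorted_words_def)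
    then obtain vs v where us: "us = vs @ [v]" "length vs = Suc (length xs)"
      by (metis length_Suc_conv_rev)
    have v: "w \<le> v" if "w \<in> set vs" for w
      using successively_zip_bound[of vs "xs @ [a]" b v w] that us \<open>us \<in> sorted_words (xs @ [a, b]) (Suc N)\<close>
      by (simp add: sorted_words_def)
    have "v = N"
    proof (rule ccontr)
      assume "v \<noteq> N"
      then have "v < N" using that(1) us by (auto simp: sorted_words_def)
      then have "set us \<subseteq> {..<N}" using v us by (auto intro: le_less_trans)
      then show False using that by (auto simp: sorted_words_def)
    qed
    then show ?thesis using that(1) sub[of vs] us by blast
  qed
  moreover have "sorted_words (xs @ [a, b]) N \<subseteq> sorted_words (xs @ [a, b]) (Suc N)"
    by (auto simp: sorted_words_def)
  ultimately have "sorted_words (xs @ [a, b]) (Suc N) = sorted_words (xs @ [a, b]) N \<union> ?T"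
    using sub by blast
  moreover have "sorted_words (xs @ [a, b]) N \<inter> ?T = {}"
    by (auto simp: sorted_words_def)
  ultimately have "card (sorted_words (xs @ [a, b]) (Suc N)) = card (sorted_words (xs @ [a, b]) N) + card ?T"
    by (simp add: card_Un_disjoint finite_sorted_words)
  moreover have "card ?T = card (sorted_words (xs @ [a]) ?M)"
    by (rule card_image) (auto simp: inj_on_def)
  ultimately show ?thesis by simp
qed

section \<open>Generating functions of words and left peaks\<close>

definition even_gf :: "'a::linorder list \<Rightarrow> real fps" where
  "even_gf xs = Abs_fps (\<lambda>m. real (card (sorted_words xs (2 * m + 1))))"

text \<open>The bound \<open>2 * m + 1\<close> admits the codes of 0, -1, 1, ..., -m, m, and
  \<open>2 * m\<close> all of these but m. The parity of the largest value decides how ties are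
  broken, so both series are needed to close the recursion.\<close>

definition odd_gf :: "'a::linorder list \<Rightarrow> real fps" where
  "odd_gf xs = Abs_fps (\<lambda>m. real (card (sorted_words xs (2 * m))))"

lemma gf_ascent:
  assumes "a < b"
  shows "even_gf (xs @ [a, b]) = odd_gf (xs @ [a, b]) + even_gf (xs @ [a])"
    and "odd_gf (xs @ [a, b]) = fps_X * (even_gf (xs @ [a, b]) + even_gf (xs @ [a]))"
proof -
  show "even_gf (xs @ [a, b]) = odd_gf (xs @ [a, b]) + even_gf (xs @ [a])"
    using assms by (intro fps_ext) (simp add: even_gf_def odd_gf_def card_sorted_words_Suc)
  show "odd_gf (xs @ [a, b]) = fps_X * (even_gf (xs @ [a, b]) + even_gf (xs @ [a]))"
  proof (rule fps_ext)
    fix m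
    show "fps_nth (odd_gf (xs @ [a, b])) m = fps_nth (fps_X * (even_gf (xs @ [a, b]) + even_gf (xs @ [a]))) m"
      using assms card_sorted_words_Suc[of a b xs "Suc (2 * (m - 1))"]
      by (cases m) (simp_all add: even_gf_def odd_gf_def sorted_words_0)
  qed
qed

lemma gf_descent:
  assumes "b < a"
  shows "even_gf (xs @ [a, b]) = odd_gf (xs @ [a, b]) + odd_gf (xs @ [a])"
    and "odd_gf (xs @ [a, b]) = fps_X * even_gf (xs @ [a, b]) + odd_gf (xs @ [a])"
proof -
  show "even_gf (xs @ [a, b]) = odd_gf (xs @ [a, b]) + odd_gf (xs @ [a])"
    using assms by (intro fps_ext) (simp add: even_gf_def odd_gf_def card_sorted_words_Suc)
  show "odd_gf (xs @ [a, b]) = fps_X * even_gf (xs @ [a, b]) + odd_gf (xs @ [a])"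
  proof (rule fps_ext)
    fix m
    show "fps_nth (odd_gf (xs @ [a, b])) m = fps_nth (fps_X * even_gf (xs @ [a, b]) + odd_gf (xs @ [a])) m"
      using assms card_sorted_words_Suc[of a b xs "Suc (2 * (m - 1))"]
      by (cases m) (simp_all add: even_gf_def odd_gf_def sorted_words_0)
  qed
qed

text \<open>The first letter behaves as if it followed an ascent: the last two equations are those
  of \<open>gf_ascent\<close> with the empty word as prefix. This matches the sentinel below all
  labels in \<open>left_peaks\<close>.\<close>

lemma gf_singleton:
  fixes a :: "'a::linorder"
  shows "(1 - fps_X) * even_gf ([] :: 'a list) = 1"
    and "even_gf [a] = odd_gf [a] + even_gf ([] :: 'a list)"
    and "odd_gf [a] = fps_X * (even_gf [a] + even_gf ([] :: 'a list))"
proof -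
  have nil: "sorted_words ([] :: 'a list) N = {[]}" for N :: nat
    by (auto simp: sorted_words_def)
  then have e: "even_gf ([] :: 'a list) = Abs_fps (\<lambda>_. 1)"
    by (simp add: even_gf_def)
  show "(1 - fps_X) * even_gf ([] :: 'a list) = 1"
    by (rule fps_ext) (simp add: e left_diff_distrib)
  show "even_gf [a] = odd_gf [a] + even_gf ([] :: 'a list)"
    by (rule fps_ext) (simp add: nil even_gf_def odd_gf_def card_sorted_words_singleton)
  show "odd_gf [a] = fps_X * (even_gf [a] + even_gf ([] :: 'a list))"
  proof (rule fps_ext)
    fix m
    show "fps_nth (odd_gf [a]) m = fps_nth (fps_X * (even_gf [a] + even_gf ([] :: 'a list))) m"
      by (cases m) (simp_all add: nil even_gf_def odd_gf_def card_sorted_words_singleton)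
  qed
qed

lemma left_peaks_snoc:
  "left_peaks (xs @ [a, b]) =
     left_peaks (xs @ [a]) + (if b < a \<and> (xs = [] \<or> last xs < a) then 1 else 0)"
proof -
  let ?S = "\<lambda>\<pi>. {i. i + 1 < length \<pi> \<and> (i = 0 \<or> \<pi> ! (i - 1) < \<pi> ! i) \<and> \<pi> ! i > \<pi> ! (i + 1)}"
  let ?n = "length xs"
  have fin: "finite (?S \<pi>)" for \<pi> :: "'a list" 
    by (rule finite_subset[of _ "{..<length \<pi>}"]) auto
  have *: "i \<in> ?S (xs @ [a, b]) \<longleftrightarrow> i \<in> ?S (xs @ [a]) \<or> i = ?n \<and> b < a \<and> (xs = [] \<or> last xs < a)" for i
  proof (cases i ?n rule: linorder_cases)
    case less
    then show ?thesis by (auto simp: nth_append)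
  next
    case equal
    then show ?thesis by (cases "xs = []") (auto simp: nth_append last_conv_nth)
  qed auto
  have "?S (xs @ [a, b]) = ?S (xs @ [a]) \<union> (if b < a \<and> (xs = [] \<or> last xs < a) then {?n} else {})"
    using * by (auto split: if_splits)
  moreover have "?n \<notin> ?S (xs @ [a])" by simp
  ultimately show ?thesis
    unfolding left_peaks_def using fin[of "xs @ [a]"] by auto
qed

lemma one_pm_fps_X_nonzero: "1 - fps_X \<noteq> (0 :: real fps)" "1 + fps_X \<noteq> (0 :: real fps)"
  using arg_cong[of "1 + fps_X" "0 :: real fps" "\<lambda>f. fps_nth f 0"] by auto

text \<open>The ratio of \<open>H\<close> to \<open>G\<close> is the state of the recursion:
  2x/(1+x) at the start or after an ascent, (1+x)/2 after a descent. In the first state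
  \<open>2 * k < n\<close> is strict, leaving room for the peak that a following descent
  completes.\<close>

lemma even_gf_snoc:
  fixes a :: "'a::linorder"
  assumes "distinct (xs @ [a])" "n = Suc (length xs)" "k = left_peaks (xs @ [a])"
    "G = even_gf (xs @ [a])" "H = odd_gf (xs @ [a])"
  shows "2 * k \<le> n \<and>
    (1 - fps_X) ^ Suc n * G = (4 * fps_X) ^ k * (1 + fps_X) ^ (n - 2 * k) \<and>
    (if xs = [] \<or> last xs < a then 2 * k < n \<and> (1 + fps_X) * H = 2 * fps_X * G
     else 2 * H = (1 + fps_X) * G)"
  using assms
proof (induction xs arbitrary: a n k G H rule: rev_induct)
  case Nil
  define e where "e = even_gf ([] :: 'a list)"
  have e: "(1 - fps_X) * e = 1" "even_gf [a] = odd_gf [a] + e" "odd_gf [a] = fps_X * (even_gf [a] + e)"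
    using gf_singleton unfolding e_def by blast+
  then have 1: "(1 - fps_X) * even_gf [a] = (1 + fps_X) * e" "(1 - fps_X) * odd_gf [a] = 2 * fps_X * e"
    by algebra+
  have "(1 - fps_X) ^ 2 * even_gf [a] = 1 + fps_X"
    using 1 e by algebra
  moreover have "(1 - fps_X) * ((1 + fps_X) * odd_gf [a]) = (1 - fps_X) * (2 * fps_X * even_gf [a])"
    using 1 by algebra
  then have "(1 + fps_X) * odd_gf [a] = 2 * fps_X * even_gf [a]"
    using one_pm_fps_X_nonzero by (simp del: mult.assoc)
  moreover have "left_peaks [a] = 0"
    by (simp add: left_peaks_def)
  ultimately show ?case
    unfolding Nil by (simp add: numeral_2_eq_2)
next
  case (snoc c xs b n' k' G' H')
  define n k G H where "n = Suc (length xs)" and "k = left_peaks (xs @ [c])"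
    and "G = even_gf (xs @ [c])" and "H = odd_gf (xs @ [c])"
  have IH: "2 * k \<le> n" "(1 - fps_X) ^ Suc n * G = (4 * fps_X) ^ k * (1 + fps_X) ^ (n - 2 * k)"
    "if xs = [] \<or> last xs < c then 2 * k < n \<and> (1 + fps_X) * H = 2 * fps_X * G
     else 2 * H = (1 + fps_X) * G"
    using snoc.IH[of c] snoc.prems(1) unfolding n_def k_def G_def H_def by simp_all
  have n': "n' = Suc n" and eqs: "G' = even_gf (xs @ [c, b])" "H' = odd_gf (xs @ [c, b])"
    using snoc.prems by (simp_all add: n_def)
  have k': "k' = k + (if b < c \<and> (xs = [] \<or> last xs < c) then 1 else 0)"
    using snoc.prems left_peaks_snoc[of xs c b] by (simp add: k_def)
  have cancel: "A = B" if "(1 - fps_X) * A = (1 - fps_X) * B" for A B :: "real fps"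
    using that one_pm_fps_X_nonzero by simp
  have cancel': "A = B" if "(1 + fps_X) * A = (1 + fps_X) * B" for A B :: "real fps"
    using that one_pm_fps_X_nonzero by simp
  show ?case
  proof (cases "c < b")
    case True
    \<comment> \<open>The ascent equations are linear in \<open>G'\<close> and \<open>H'\<close>.
      Solving them leaves only \<open>G\<close>, so an ascent forgets the earlier state.\<close>
    have 1: "(1 - fps_X) * G' = (1 + fps_X) * G" "(1 - fps_X) * H' = 2 * fps_X * G"
      using gf_ascent[OF True, of xs] unfolding eqs[symmetric] G_def[symmetric] by algebra+
    have "(1 - fps_X) ^ Suc n' * G' = (1 + fps_X) * ((1 - fps_X) ^ Suc n * G)"
      using 1 unfolding n' by (simp add: mult_ac)
    also have "\<dots> = (4 * fps_X) ^ k * (1 + fps_X) ^ (n' - 2 * k)"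
      unfolding IH n' using IH(1) by (simp add: Suc_diff_le mult_ac)
    finally have "(1 - fps_X) ^ Suc n' * G' = (4 * fps_X) ^ k * (1 + fps_X) ^ (n' - 2 * k)" .
    moreover have "(1 + fps_X) * H' = 2 * fps_X * G'"
      by (rule cancel) (use 1 in algebra)
    moreover have "k' = k" using True k' by auto
    ultimately show ?thesis
      using True IH(1) n' by simp
  next
    case False
    then have False: "b < c" using snoc.prems(1) by auto
    \<comment> \<open>After a descent only \<open>H\<close> remains, so the state of the prefix
      decides the factor.\<close>
    have 1: "(1 - fps_X) * G' = 2 * H" "(1 - fps_X) * H' = (1 + fps_X) * H"
      using gf_descent[OF False, of xs] unfolding eqs[symmetric] H_def[symmetric] by algebra+
    have 2: "2 * H' = (1 + fps_X) * G'"
      by (rule cancel) (use 1 in algebra)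
    show ?thesis
    proof (cases "xs = [] \<or> last xs < c")
      case True
      then have IH3: "2 * k < n" "(1 + fps_X) * H = 2 * fps_X * G" using IH(3) by simp_all
      \<comment> \<open>A left peak is completed at \<open>c\<close>. The state gives only
        \<open>(1 + fps_X) * H\<close>, so this factor is carried along and cancelled at the
        end.\<close>
      have "(1 + fps_X) * ((1 - fps_X) ^ Suc n' * G') = 2 * (1 - fps_X) ^ Suc n * ((1 + fps_X) * H)"
        using 1 unfolding n' by (simp add: mult_ac)
      also have "\<dots> = 4 * fps_X * ((1 - fps_X) ^ Suc n * G)"
        unfolding IH3 by (simp add: mult_ac)
      also have "\<dots> = (1 + fps_X) * ((4 * fps_X) ^ k' * (1 + fps_X) ^ (n' - 2 * k'))"
      proof -
        obtain r where r: "n = Suc (2 * k + r)" using less_imp_Suc_add[OF IH3(1)] by auto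
        then have "n - 2 * k = Suc r" "k' = Suc k" "n' - 2 * k' = r"
          using True False k' n' by auto
        then show ?thesis
          unfolding IH by (simp only: power_Suc mult_ac)
      qed
      finally have "(1 - fps_X) ^ Suc n' * G' = (4 * fps_X) ^ k' * (1 + fps_X) ^ (n' - 2 * k')"
        by (rule cancel')
      then show ?thesis using True False IH3 k' n' 2 by auto
    next
      case F2: False
      then have "2 * H = (1 + fps_X) * G" using IH(3) by simp
      with 1 have 1: "(1 - fps_X) * G' = (1 + fps_X) * G" by simp
      have "(1 - fps_X) ^ Suc n' * G' = (1 + fps_X) * ((1 - fps_X) ^ Suc n * G)"
        using 1 unfolding n' by (simp add: mult_ac)
      also have "\<dots> = (4 * fps_X) ^ k * (1 + fps_X) ^ (n' - 2 * k)"
        unfolding IH n' using IH(1) by (simp add: Suc_diff_le mult_ac)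
      finally show ?thesis using F2 False IH(1) k' n' 2 by auto
    qed
  qed
qed

lemma even_gf_left_peaks:
  assumes "distinct xs" "xs \<noteq> []"
  shows "2 * left_peaks xs \<le> length xs"
    and "(1 - fps_X) ^ (length xs + 1) * even_gf xs =
      (4 * fps_X) ^ left_peaks xs * (1 + fps_X) ^ (length xs - 2 * left_peaks xs)"
proof -
  obtain ys a where "xs = ys @ [a]" using assms(2) by (metis rev_exhaust)
  then show "2 * left_peaks xs \<le> length xs"
    and "(1 - fps_X) ^ (length xs + 1) * even_gf xs =
      (4 * fps_X) ^ left_peaks xs * (1 + fps_X) ^ (length xs - 2 * left_peaks xs)"
    using even_gf_snoc[of ys a] assms(1) by simp_all
qed

section \<open>Left enriched partitions\<close>

text \<open>For the coded integers f this reads: if i is strictly below j, then |f(i)| is at most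
  |f(j)|, with equality only if f(j) is nonnegative. The bound \<open>2 * m + 1\<close> means |f| at
  most m.\<close>

definition enriched_partitions :: "('n::finite) rel \<Rightarrow> nat \<Rightarrow> ('n \<Rightarrow> nat) set" where
  "enriched_partitions R N =
     {u. (\<forall>i. u i < N) \<and> (\<forall>i j. (i, j) \<in> R \<and> i \<noteq> j \<longrightarrow> u i < u j \<or> u i = u j \<and> even (u i))}"

lemma finite_enriched_partitions:
  fixes R :: "('n::finite) rel"
  shows "finite (enriched_partitions R N)"
proof -
  have "finite (Pi\<^sub>E (UNIV :: 'n set) (\<lambda>_. {..<N}))" by (rule finite_PiE) auto
  then show ?thesis
    by (rule finite_subset[rotated]) (auto simp: enriched_partitions_def)
qed

text \<open>Distinct labels break every tie of \<open>u\<close>, so the sorting criterion is a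
  strict linear order on the labels, and a finite linear order has exactly one sorted list.\<close>

lemma ex1_sorted_permutation:
  fixes u :: "'n::{finite,linorder} \<Rightarrow> nat"
  shows "\<exists>!\<pi>. \<pi> \<in> permutations_of_set UNIV \<and> sorted_wrt (\<lambda>i j. label_order (i, u i) (j, u j)) \<pi>"
proof -
  define lt where "lt = (\<lambda>i j. label_order (i, u i) (j, u j))"
  define le where "le = (\<lambda>i j. lt i j \<or> i = j)"
  have irr: "\<not> lt i i" and tr: "lt i j \<Longrightarrow> lt j k \<Longrightarrow> lt i k" and tot: "lt i j \<or> i = j \<or> lt j i" for i j k
    by (auto simp: lt_def label_order_def split: if_splits)
  interpret L: linorder le lt
    by (unfold_locales; unfold le_def; use irr tr tot in blast)
  have "\<pi> \<in> permutations_of_set UNIV \<and> sorted_wrt lt \<pi> \<longleftrightarrow> L.sorted_list_of_set UNIV = \<pi>" for \<pi>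
  proof -
    have "L.sorted_list_of_set UNIV = \<pi> \<longleftrightarrow> sorted_wrt lt \<pi> \<and> set \<pi> = UNIV \<and> length \<pi> = card (UNIV :: 'n set)"
      using L.sorted_list_of_set.sorted_key_list_of_set_unique[of UNIV \<pi>] by simp
    moreover have "distinct \<pi> \<longleftrightarrow> length \<pi> = card (UNIV :: 'n set)" if "set \<pi> = UNIV"
      using that by (metis card_distinct distinct_card)
    ultimately show ?thesis by (auto simp: permutations_of_set_def)
  qed
  then have "\<exists>!\<pi>. \<pi> \<in> permutations_of_set UNIV \<and> sorted_wrt lt \<pi>"
    by simp
  then show ?thesis unfolding lt_def .
qed

lemma sorted_words_conv_functions:
  assumes "\<pi> \<in> permutations_of_set (UNIV :: 'n::{finite,linorder} set)"
  shows "bij_betw (\<lambda>u. map u \<pi>)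
    {u. (\<forall>i. u i < N) \<and> sorted_wrt (\<lambda>i j. label_order (i, u i) (j, u j)) \<pi>} (sorted_words \<pi> N)"
    (is "bij_betw _ ?A _")
proof -
  have \<pi>: "set \<pi> = UNIV" "distinct \<pi>" using assms by (simp_all add: permutations_of_set_def)
  have tr: "transp (\<lambda>i j. label_order (i, u i) (j, u j))" for u :: "'n \<Rightarrow> nat"
    using transp_label_order by (auto intro!: transpI dest: transpD)
  have z: "zip \<pi> (map u \<pi>) = map (\<lambda>i. (i, u i)) \<pi>" for u :: "'n \<Rightarrow> nat"
    by (induction \<pi>) auto
  have "set (map u \<pi>) \<subseteq> {..<N} \<longleftrightarrow> (\<forall>i. u i < N)" for u
    using \<pi>(1) by auto
  then have *: "map u \<pi> \<in> sorted_words \<pi> N \<longleftrightarrow> u \<in> ?A" for u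
    unfolding sorted_words_def z successively_map successively_conv_sorted_wrt[OF tr] mem_Collect_eq
    by simp
  show ?thesis
  proof (rule bij_betw_imageI)
    show "inj_on (\<lambda>u. map u \<pi>) ?A"
    proof (intro inj_onI ext)
      fix u v i assume "map u \<pi> = map v \<pi>"
      then show "u i = v i" using \<pi>(1) by (simp add: map_eq_conv)
    qed
    show "(\<lambda>u. map u \<pi>) ` ?A = sorted_words \<pi> N"
    proof (intro equalityI subsetI)
      fix us assume us: "us \<in> sorted_words \<pi> N"
      define u where "u i = the (map_of (zip \<pi> us) i)" for i
      have len: "length \<pi> = length us" using us by (simp add: sorted_words_def)
      then have "us = map u \<pi>"
        using map_of_zip_nth[OF len \<pi>(2)] by (intro nth_equalityI) (simp_all add: u_def)
      moreover from this have "u \<in> ?A" using us by (simp only: *)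
      ultimately show "us \<in> (\<lambda>u. map u \<pi>) ` ?A" by (rule image_eqI)
    next
      fix us assume "us \<in> (\<lambda>u. map u \<pi>) ` ?A"
      then show "us \<in> sorted_words \<pi> N" by (elim imageE) (simp only: *)
    qed
  qed
qed

text \<open>
  Sorting the elements by \<open>u\<close>, with ties broken upwards at even and downwards at odd values,
  sends each enriched partition \<open>u\<close> to exactly one linear extension.
\<close>
lemma card_enriched_partitions:
  fixes R :: "('n::{finite,linorder}) rel"
  assumes "naturally_labeled R"
  shows "card (enriched_partitions R N) = (\<Sum>\<pi>\<in>linear_extensions R. card (sorted_words \<pi> N))"
proof -
  define srt where "srt u \<pi> = sorted_wrt (\<lambda>i j. label_order (i, u i) (j, u j)) \<pi>"
    for u :: "'n \<Rightarrow> nat" and \<pi>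
  have fin: "finite (linear_extensions R)"
    unfolding linear_extensions_def by (rule finite_subset[OF Collect_restrict]) simp
  have lo: "\<not> (label_order (i, u i) (j, u j) \<and> label_order (j, u j) (i, u i))" for i j and u :: "'n \<Rightarrow> nat"
    by (simp add: label_order_def) (metis less_asym)
  have sort: "label_order (\<pi> ! a, u (\<pi> ! a)) (\<pi> ! b, u (\<pi> ! b))"
    if "srt u \<pi>" "a < b" "b < length \<pi>" for u \<pi> a b
    using that unfolding srt_def sorted_wrt_iff_nth_less by blast
  have le: "\<pi> \<in> linear_extensions R"
    if u: "u \<in> enriched_partitions R N" and \<pi>: "\<pi> \<in> permutations_of_set UNIV" "srt u \<pi>" for u \<pi>
    unfolding linear_extensions_def
  proof (intro CollectI conjI allI impI \<pi>(1))
    fix a b assume ab: "a < length \<pi> \<and> b < length \<pi> \<and> (\<pi> ! a, \<pi> ! b) \<in> R \<and> \<pi> ! a \<noteq> \<pi> ! b"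
    \<comment> \<open>A comparable pair can tie only at an even value, where the smaller label comes
      first; by natural labeling this is the lower element of the poset.\<close>
    then have "\<pi> ! a < \<pi> ! b" "u (\<pi> ! a) < u (\<pi> ! b) \<or> u (\<pi> ! a) = u (\<pi> ! b) \<and> even (u (\<pi> ! a))"
      using u assms unfolding enriched_partitions_def naturally_labeled_def by blast+
    then have "label_order (\<pi> ! a, u (\<pi> ! a)) (\<pi> ! b, u (\<pi> ! b))"
      by (auto simp: label_order_def)
    then have "\<not> b < a"
      using sort[OF \<pi>(2), of b a] ab lo[of "\<pi> ! a" u "\<pi> ! b"] by blast
    moreover have "a \<noteq> b" using ab by metis
    ultimately show "a < b" by simp
  qed
  have ep: "u \<in> enriched_partitions R N"
    if u: "\<forall>i. u i < N" and \<pi>: "\<pi> \<in> linear_extensions R" "srt u \<pi>" for u \<pi>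
    unfolding enriched_partitions_def
  proof (intro CollectI conjI allI impI)
    fix i j :: 'n assume ij: "(i, j) \<in> R \<and> i \<noteq> j"
    have "set \<pi> = UNIV" using \<pi>(1) by (auto simp: linear_extensions_def permutations_of_set_def)
    then have "\<exists>a<length \<pi>. \<pi> ! a = i" for i
      by (simp flip: in_set_conv_nth)
    then obtain a b where ab: "a < length \<pi>" "\<pi> ! a = i" "b < length \<pi>" "\<pi> ! b = j"
      by blast
    then have "a < b" using \<pi>(1) ij unfolding linear_extensions_def by blast
    then have "label_order (i, u i) (j, u j)"
      using sort[OF \<pi>(2), of a b] ab by simp
    moreover have "i < j" using ij assms unfolding naturally_labeled_def by blast
    ultimately show "u i < u j \<or> u i = u j \<and> even (u i)"
      by (auto simp: label_order_def split: if_splits)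
  qed (use u in simp)
  have eq: "enriched_partitions R N = (\<Union>\<pi>\<in>linear_extensions R. {u. (\<forall>i. u i < N) \<and> srt u \<pi>})"
  proof (intro equalityI subsetI)
    fix u assume u: "u \<in> enriched_partitions R N"
    obtain \<pi> where "\<pi> \<in> permutations_of_set UNIV" "srt u \<pi>"
      using ex1_sorted_permutation[of u, folded srt_def] by (elim ex1E conjE)
    then show "u \<in> (\<Union>\<pi>\<in>linear_extensions R. {u. (\<forall>i. u i < N) \<and> srt u \<pi>})"
      using u le unfolding enriched_partitions_def by blast
  next
    fix u assume "u \<in> (\<Union>\<pi>\<in>linear_extensions R. {u. (\<forall>i. u i < N) \<and> srt u \<pi>})"
    then show "u \<in> enriched_partitions R N" by (elim UN_E CollectE conjE) (rule ep)
  qed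
  have perm: "\<pi> \<in> permutations_of_set UNIV" if "\<pi> \<in> linear_extensions R" for \<pi>
    using that by (simp add: linear_extensions_def)
  have "card (enriched_partitions R N) =
      (\<Sum>\<pi>\<in>linear_extensions R. card {u. (\<forall>i. u i < N) \<and> srt u \<pi>})"
    unfolding eq
  proof (rule card_UN_disjoint[OF fin])
    show "\<forall>\<pi>\<in>linear_extensions R. finite {u. (\<forall>i. u i < N) \<and> srt u \<pi>}"
    proof
      fix \<pi> assume "\<pi> \<in> linear_extensions R"
      then have "{u. (\<forall>i. u i < N) \<and> srt u \<pi>} \<subseteq> enriched_partitions R N" using ep by blast
      then show "finite {u. (\<forall>i. u i < N) \<and> srt u \<pi>}"
        using finite_enriched_partitions finite_subset by blast
    qed
    show "\<forall>\<pi>\<in>linear_extensions R. \<forall>\<rho>\<in>linear_extensions R. \<pi> \<noteq> \<rho> \<longrightarrow>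
        {u. (\<forall>i. u i < N) \<and> srt u \<pi>} \<inter> {u. (\<forall>i. u i < N) \<and> srt u \<rho>} = {}"
    proof (intro ballI impI equals0I)
      fix \<pi> \<rho> u
      assume "\<pi> \<in> linear_extensions R" "\<rho> \<in> linear_extensions R" and ne: "\<pi> \<noteq> \<rho>"
        and u: "u \<in> {u. (\<forall>i. u i < N) \<and> srt u \<pi>} \<inter> {u. (\<forall>i. u i < N) \<and> srt u \<rho>}"
      then have "\<pi> \<in> permutations_of_set UNIV \<and> srt u \<pi>" "\<rho> \<in> permutations_of_set UNIV \<and> srt u \<rho>"
        using perm by simp_all
      with ex1_sorted_permutation[of u, folded srt_def] have "\<pi> = \<rho>" by (elim ex1E) blast
      then show False using ne by simp
    qed
  qed
  also have "\<dots> = (\<Sum>\<pi>\<in>linear_extensions R. card (sorted_words \<pi> N))"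
    unfolding srt_def
    by (intro sum.cong refl bij_betw_same_card[OF sorted_words_conv_functions[OF perm]])
  finally show ?thesis .
qed

section \<open>The transfer map from enriched partitions to lattice points\<close>

lemma wf_strict_part:
  fixes S :: "('n::finite) rel"
  assumes "partial_order_on UNIV S"
  shows "wf (S - Id)"
proof (rule finite_acyclic_wf)
  have "trans S" "antisym S" using assms by (auto simp: order_on_defs)
  then show "acyclic (S - Id)" by (simp add: acyclic_irrefl trans_diff_Id)
qed simp

text \<open>
  The height \<open>y\<^sub>j\<close> bounds the sum of \<open>x\<close> along every chain with top \<open>j\<close>, so for \<open>x \<ge> 0\<close> this says that
  all chain sums are at most \<open>t\<close>.
\<close>
definition chain_bounded :: "'n rel \<Rightarrow> real \<Rightarrow> ('n \<Rightarrow> real) \<Rightarrow> bool" where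
  "chain_bounded S t x \<longleftrightarrow> (\<exists>y. \<forall>j. 0 \<le> x j \<and> x j \<le> y j \<and> y j \<le> t \<and>
     (\<forall>i. (i, j) \<in> S \<and> i \<noteq> j \<longrightarrow> y i + x j \<le> y j))"

text \<open>Only absolute values enter besides integrality, so sign changes preserve membership. For
  posets these are the lattice points of the \<open>m\<close>-fold enriched chain polytope, by
  \<open>enriched_chain_polytope_lattice_points\<close>.\<close>

definition enriched_points :: "('n::finite) rel \<Rightarrow> nat \<Rightarrow> (real ^ 'n) set" where
  "enriched_points S m = {z \<in> lattice_points. chain_bounded S (real m) (\<lambda>i. \<bar>z $ i\<bar>)}"

text \<open>The inserted \<open>0\<close> is the value at minimal elements.\<close>
definition height_below :: "('n::finite) rel \<Rightarrow> ('n \<Rightarrow> nat) \<Rightarrow> 'n \<Rightarrow> nat" where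
  "height_below S y j = Max (insert 0 (y ` {i. (i, j) \<in> S - Id}))"

lemma height_below_le_iff:
  "height_below S y j \<le> k \<longleftrightarrow> (\<forall>i. (i, j) \<in> S \<and> i \<noteq> j \<longrightarrow> y i \<le> k)"
  unfolding height_below_def by (subst Max_le_iff) auto

lemma le_height_below: "(i, j) \<in> S \<Longrightarrow> i \<noteq> j \<Longrightarrow> y i \<le> height_below S y j"
  using height_below_le_iff by blast

lemma height_below_cong:
  "(\<And>i. (i, j) \<in> S - Id \<Longrightarrow> y i = y' i) \<Longrightarrow> height_below S y j = height_below S y' j"
  unfolding height_below_def by (intro arg_cong[where f = Max] arg_cong2[where f = insert] image_cong) auto

text \<open>In the encoding \<open>(u j + 1) div 2\<close> is the absolute value of the coded
  integer and the parity of \<open>u j\<close> is its sign. The transfer map acts on the absolute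
  values, and the signs are carried along.\<close>

definition signed_heights :: "('n::finite) rel \<Rightarrow> ('n \<Rightarrow> nat) \<Rightarrow> real ^ 'n" where
  "signed_heights S u = (\<chi> j. (if even (u j) then 1 else -1) *
     (real ((u j + 1) div 2) - real (height_below S (\<lambda>i. (u i + 1) div 2) j)))"

text \<open>An odd \<open>u j\<close> forces \<open>u i < u j\<close> for all \<open>i\<close>
  strictly below \<open>j\<close>, hence a smaller absolute value. So a coordinate that receives a
  minus sign is never zero, and no sign is lost.\<close>

lemma height_below_enriched_partition:
  assumes "u \<in> enriched_partitions S N"
  shows "height_below S (\<lambda>i. (u i + 1) div 2) j \<le> (u j + 1) div 2"
    and "odd (u j) \<Longrightarrow> height_below S (\<lambda>i. (u i + 1) div 2) j < (u j + 1) div 2"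
proof -
  have *: "u i < u j \<or> u i = u j \<and> even (u i)" if "(i, j) \<in> S" "i \<noteq> j" for i
    using assms that by (auto simp: enriched_partitions_def)
  show "height_below S (\<lambda>i. (u i + 1) div 2) j \<le> (u j + 1) div 2"
    unfolding height_below_le_iff by (auto dest!: * intro!: div_le_mono)
  assume odd: "odd (u j)"
  then have "height_below S (\<lambda>i. (u i + 1) div 2) j \<le> u j div 2"
    unfolding height_below_le_iff using * by (fastforce intro!: div_le_mono)
  also have "u j div 2 < (u j + 1) div 2" using odd by presburger
  finally show "height_below S (\<lambda>i. (u i + 1) div 2) j < (u j + 1) div 2" .
qed

text \<open>
  The inverse recovers the heights \<open>y\<close> from \<open>\<bar>z\<bar>\<close> by \<open>y\<^sub>j = \<bar>z\<^sub>j\<bar> + max {y\<^sub>i | i < j}\<close>, as in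
  Stanley's transfer map between the order and the chain polytope.
\<close>
lemma bij_betw_signed_heights:
  fixes S :: "('n::finite) rel"
  assumes "partial_order_on UNIV S"
  shows "bij_betw (signed_heights S) (enriched_partitions S (2 * m + 1)) (enriched_points S m)"
proof (rule bij_betw_imageI)
  note wf = wf_strict_part[OF assms]
  show "inj_on (signed_heights S) (enriched_partitions S (2 * m + 1))"
  proof (rule inj_onI, rule ext)
    fix u v i
    assume u: "u \<in> enriched_partitions S (2 * m + 1)" and v: "v \<in> enriched_partitions S (2 * m + 1)"
      and eq: "signed_heights S u = signed_heights S v"
    show "u i = v i"
    proof (induction i rule: wf_induct_rule[OF wf])
      case (1 j)
      let ?h = "height_below S (\<lambda>i. (u i + 1) div 2) j"
      have h: "height_below S (\<lambda>i. (v i + 1) div 2) j = ?h"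
        using 1 by (intro height_below_cong) auto
      have z: "signed_heights S u $ j = signed_heights S v $ j" using eq by simp
      have aux: "p = q \<and> a = b"
        if "(if p then 1 else -1) * (real a - real c) = (if q then 1 else -1) * (real b - real c)"
          "c \<le> a" "\<not> p \<Longrightarrow> c < a" "c \<le> b" "\<not> q \<Longrightarrow> c < b" for p q a b c
        using that by (auto split: if_splits)
      have "even (u j) = even (v j) \<and> (u j + 1) div 2 = (v j + 1) div 2"
        using z height_below_enriched_partition[OF u, of j] height_below_enriched_partition[OF v, of j]
        unfolding signed_heights_def vec_lambda_beta h by (rule aux)
      then show ?case by presburger
    qed
  qed
  show "signed_heights S ` enriched_partitions S (2 * m + 1) = enriched_points S m"
  proof (intro equalityI subsetI)
    fix z assume "z \<in> signed_heights S ` enriched_partitions S (2 * m + 1)"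
    then obtain u where u: "u \<in> enriched_partitions S (2 * m + 1)" and z: "z = signed_heights S u"
      by blast
    let ?y = "\<lambda>i. (u i + 1) div 2"
    have abs: "\<bar>z $ j\<bar> = real (?y j) - real (height_below S ?y j)" for j
      using height_below_enriched_partition(1)[OF u, of j] by (simp add: z signed_heights_def abs_mult)
    have "chain_bounded S (real m) (\<lambda>i. \<bar>z $ i\<bar>)"
      unfolding chain_bounded_def
    proof (intro exI[of _ "\<lambda>j. real (?y j)"] allI conjI impI)
      fix j
      show "\<bar>z $ j\<bar> \<le> real (?y j)" by (simp add: abs)
      have "u j \<le> 2 * m" using u by (auto simp: enriched_partitions_def less_Suc_eq_le)
      then show "real (?y j) \<le> real m" by simp
      fix i assume "(i, j) \<in> S \<and> i \<noteq> j"
      then show "real (?y i) + \<bar>z $ j\<bar> \<le> real (?y j)"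
        using le_height_below[of i j S ?y] by (simp add: abs)
    qed simp
    moreover have "z \<in> lattice_points"
      by (auto simp: lattice_points_def z signed_heights_def)
    ultimately show "z \<in> enriched_points S m" by (simp add: enriched_points_def)
  next
    fix z assume z: "z \<in> enriched_points S m"
    define X where "X j = nat \<lfloor>\<bar>z $ j\<bar>\<rfloor>" for j
    have X: "\<bar>z $ j\<bar> = real (X j)" for j
      using z by (auto simp: X_def enriched_points_def lattice_points_def elim!: Ints_cases dest!: spec[of _ j])
    obtain y where y: "\<bar>z $ j\<bar> \<le> y j" "y j \<le> real m"
      "(i, j) \<in> S \<Longrightarrow> i \<noteq> j \<Longrightarrow> y i + \<bar>z $ j\<bar> \<le> y j" for i j
      using z by (auto simp: enriched_points_def chain_bounded_def)
    \<comment> \<open>These heights are integral and the least possible, so they stay below the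
      given \<open>y\<close> and thus do not exceed \<open>m\<close>.\<close>
    have "\<exists>Y. \<forall>j. Y j = X j + height_below S Y j"
    proof (rule dependent_wf_choice[OF wf])
      fix Y g :: "'n \<Rightarrow> nat" and j r assume "\<And>i. (i, j) \<in> S - Id \<Longrightarrow> Y i = g i"
      then have "height_below S Y j = height_below S g j" by (rule height_below_cong)
      then show "(r = X j + height_below S Y j) = (r = X j + height_below S g j)" by simp
    qed blast
    then obtain Y where Y: "Y j = X j + height_below S Y j" for j by blast
    have Yy: "real (Y j) \<le> y j" for j
    proof (induction j rule: wf_induct_rule[OF wf])
      case (1 j)
      have "height_below S Y j \<in> insert 0 (Y ` {i. (i, j) \<in> S - Id})"
        unfolding height_below_def by (rule Max_in) auto
      then consider "height_below S Y j = 0" | i where "(i, j) \<in> S - Id" "height_below S Y j = Y i"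
        by (elim insertE imageE) auto
      then show ?case
      proof cases
        case 1
        then show ?thesis using y(1)[of j] Y[of j] X[of j] by simp
      next
        case (2 i)
        then show ?thesis using y(3)[of i j] Y[of j] X[of j] "1"[of i] by simp
      qed
    qed
    \<comment> \<open>The code of -k is \<open>2 * k - 1\<close>. A negative coordinate makes
      \<open>X j\<close>, and with it \<open>Y j\<close>, positive, so the subtraction is not
      truncated.\<close>
    define u where "u j = (if z $ j < 0 then 2 * Y j - 1 else 2 * Y j)" for j
    have pos: "0 < X j" if "z $ j < 0" for j using X[of j] that by auto
    have uY: "(u j + 1) div 2 = Y j" "odd (u j) \<longleftrightarrow> z $ j < 0" for j
      using pos[of j] Y[of j] by (auto simp: u_def)
    have "u \<in> enriched_partitions S (2 * m + 1)"
      unfolding enriched_partitions_def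
    proof (intro CollectI conjI allI impI)
      fix j
      have "Y j \<le> m" using Yy[of j] y(2)[of j] by linarith
      then show "u j < 2 * m + 1" by (auto simp: u_def)
      fix i assume "(i, j) \<in> S \<and> i \<noteq> j"
      then have "Y i + X j \<le> Y j" using Y[of j] le_height_below[of i j S Y] by simp
      then show "u i < u j \<or> u i = u j \<and> even (u i)"
        using pos[of i] pos[of j] Y[of i] by (auto simp: u_def)
    qed
    moreover have "z = signed_heights S u"
    proof (rule vec_eq_iff[THEN iffD2], rule allI)
      fix j
      have "real (Y j) - real (height_below S Y j) = \<bar>z $ j\<bar>" using Y[of j] X[of j] by simp
      then show "z $ j = signed_heights S u $ j"
        unfolding signed_heights_def vec_lambda_beta uY(1) using uY(2)[of j] by auto
    qed
    ultimately show "z \<in> signed_heights S ` enriched_partitions S (2 * m + 1)" by blast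
  qed
qed

section \<open>Invariance under relabeling\<close>

lemma chain_bounded_relabel:
  fixes \<sigma> :: "'a \<Rightarrow> 'a"
  assumes "bij \<sigma>"
  shows "chain_bounded (map_prod \<sigma> \<sigma> ` S) t x \<longleftrightarrow> chain_bounded S t (\<lambda>i. x (\<sigma> i))"
proof -
  have S: "(\<sigma> i, \<sigma> j) \<in> map_prod \<sigma> \<sigma> ` S \<and> \<sigma> i \<noteq> \<sigma> j \<longleftrightarrow> (i, j) \<in> S \<and> i \<noteq> j" for i j
    using assms by (auto simp: bij_def inj_eq intro: image_eqI[of _ _ "(i, j)"])
  have all: "(\<forall>i. A i) \<longleftrightarrow> (\<forall>i. A (\<sigma> i))" for A
    using assms by (metis bij_pointE)
  have ex: "(\<exists>y. B y) \<longleftrightarrow> (\<exists>y. B (\<lambda>i. y (inv \<sigma> i)))" for B :: "('a \<Rightarrow> real) \<Rightarrow> bool"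
  proof
    assume "\<exists>y. B y"
    then obtain y where "B y" ..
    then have "B (\<lambda>i. (\<lambda>i. y (\<sigma> i)) (inv \<sigma> i))"
      using assms by (simp add: bij_is_surj surj_f_inv_f)
    then show "\<exists>y. B (\<lambda>i. y (inv \<sigma> i))" by (rule exI[of _ "\<lambda>i. y (\<sigma> i)"])
  qed blast
  have inv: "inv \<sigma> (\<sigma> i) = i" for i
    using assms by (simp add: bij_is_inj)
  show ?thesis
    unfolding chain_bounded_def
    by (subst ex, subst all, subst (2) all) (simp only: S inv)
qed

lemma card_enriched_points_relabel:
  fixes S :: "('n::finite) rel" and \<sigma> :: "'n \<Rightarrow> 'n"
  assumes "bij \<sigma>"
  shows "card (enriched_points (map_prod \<sigma> \<sigma> ` S) m) = card (enriched_points S m)"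
proof -
  let ?g = "\<lambda>z :: real ^ 'n. (\<chi> i. z $ \<sigma> i) :: real ^ 'n"
  let ?h = "\<lambda>z :: real ^ 'n. (\<chi> i. z $ inv \<sigma> i) :: real ^ 'n"
  have \<sigma>: "inv \<sigma> (\<sigma> i) = i" "\<sigma> (inv \<sigma> i) = i" for i
    using assms by (simp_all add: bij_is_inj bij_is_surj surj_f_inv_f)
  have "(\<forall>i. z $ \<sigma> i \<in> \<int>) \<longleftrightarrow> (\<forall>i. z $ i \<in> \<int>)" for z :: "real ^ 'n"
    using assms by (metis bij_pointE)
  then have g: "?g z \<in> enriched_points S m \<longleftrightarrow> z \<in> enriched_points (map_prod \<sigma> \<sigma> ` S) m" for z
    using chain_bounded_relabel[OF assms, of S "real m" "\<lambda>i. \<bar>z $ i\<bar>"]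
    by (simp add: enriched_points_def lattice_points_def)
  have gh: "?g (?h z) = z" and hg: "?h (?g z) = z" for z by (simp_all add: vec_eq_iff \<sigma>)
  have "bij_betw ?g (enriched_points (map_prod \<sigma> \<sigma> ` S) m) (enriched_points S m)"
  proof (rule bij_betw_byWitness[of _ ?h])
    show "?g ` enriched_points (map_prod \<sigma> \<sigma> ` S) m \<subseteq> enriched_points S m"
      using g by (intro image_subsetI) blast
    show "?h ` enriched_points S m \<subseteq> enriched_points (map_prod \<sigma> \<sigma> ` S) m"
      using gh by (intro image_subsetI) (metis g)
  qed (use gh hg in simp_all)
  then show ?thesis by (rule bij_betw_same_card)
qed

section \<open>Lattice points of chain polytopes\<close>

text \<open>Height functions add up. Together with scaling this makes the pairs of a bound and a
  vector a convex cone, the source of convexity in the hull arguments below.\<close>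

lemma chain_bounded_add:
  assumes "chain_bounded S s x" "chain_bounded S t x'"
  shows "chain_bounded S (s + t) (\<lambda>i. x i + x' i)"
proof -
  obtain y where y: "\<And>j. 0 \<le> x j" "\<And>j. x j \<le> y j" "\<And>j. y j \<le> s"
    "\<And>i j. (i, j) \<in> S \<Longrightarrow> i \<noteq> j \<Longrightarrow> y i + x j \<le> y j"
    using assms(1) unfolding chain_bounded_def by blast
  obtain y' where y': "\<And>j. 0 \<le> x' j" "\<And>j. x' j \<le> y' j" "\<And>j. y' j \<le> t"
    "\<And>i j. (i, j) \<in> S \<Longrightarrow> i \<noteq> j \<Longrightarrow> y' i + x' j \<le> y' j"
    using assms(2) unfolding chain_bounded_def by blast
  show ?thesis
    unfolding chain_bounded_def
  proof (intro exI[of _ "\<lambda>j. y j + y' j"] allI conjI impI)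
    fix j
    show "0 \<le> x j + x' j" "x j + x' j \<le> y j + y' j" "y j + y' j \<le> s + t"
      using y(1-3)[of j] y'(1-3)[of j] by simp_all
    fix i assume "(i, j) \<in> S \<and> i \<noteq> j"
    then show "y i + y' i + (x j + x' j) \<le> y j + y' j"
      using y(4)[of i j] y'(4)[of i j] by simp
  qed
qed

lemma chain_bounded_scale:
  assumes "chain_bounded S t x" "0 \<le> c"
  shows "chain_bounded S (c * t) (\<lambda>i. c * x i)"
proof -
  obtain y where y: "\<And>j. 0 \<le> x j" "\<And>j. x j \<le> y j" "\<And>j. y j \<le> t"
    "\<And>i j. (i, j) \<in> S \<Longrightarrow> i \<noteq> j \<Longrightarrow> y i + x j \<le> y j"
    using assms(1) unfolding chain_bounded_def by blast
  show ?thesis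
    unfolding chain_bounded_def
  proof (intro exI[of _ "\<lambda>j. c * y j"] allI conjI impI)
    fix j
    show "0 \<le> c * x j" "c * x j \<le> c * y j" "c * y j \<le> c * t"
      using y(1-3)[of j] assms(2) by (simp_all add: mult_left_mono)
    fix i assume "(i, j) \<in> S \<and> i \<noteq> j"
    then show "c * y i + c * x j \<le> c * y j"
      using mult_left_mono[OF y(4)[of i j] assms(2)] by (simp add: distrib_left)
  qed
qed

lemma indicator_vec_nth: "indicator_vec A $ j = (if j \<in> A then 1 else 0)"
proof -
  have "indicator_vec A $ j = (\<Sum>i\<in>A. if i = j then 1 else 0)"
    unfolding indicator_vec_def sum_component by (intro sum.cong) (auto simp: axis_def)
  then show ?thesis by simp
qed

lemma indicator_vec_in_chain_polytope: "antichain S A \<Longrightarrow> indicator_vec A \<in> chain_polytope S"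
  unfolding chain_polytope_def by (rule hull_inc) blast

text \<open>The bound is convex, so it is enough to check the generators, and a chain meets an
  antichain at most once.\<close>

lemma chain_polytope_chain_bounded:
  fixes S :: "('n::finite) rel"
  assumes "partial_order_on UNIV S" "x \<in> chain_polytope S"
  shows "chain_bounded S 1 (\<lambda>i. x $ i)"
proof -
  have "{indicator_vec A | A. antichain S A} \<subseteq> {x. chain_bounded S 1 (\<lambda>i. x $ i)}"
  proof clarify
    fix A assume A: "antichain S A"
    have refl: "(i, i) \<in> S" for i using assms(1) by (auto simp: order_on_defs refl_on_def)
    have trans: "(i, k) \<in> S" if "(i, j) \<in> S" "(j, k) \<in> S" for i j k
      using assms(1) that unfolding order_on_defs by (blast dest: transD)
    have anti: "i = j" if "(i, j) \<in> S" "(j, i) \<in> S" for i j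
      using assms(1) that unfolding order_on_defs by (blast dest: antisymD)
    show "chain_bounded S 1 (\<lambda>i. indicator_vec A $ i)"
      unfolding chain_bounded_def indicator_vec_nth
    \<comment> \<open>The height is the indicator of the up-set generated by
      \<open>A\<close>.\<close>
    proof (intro exI[of _ "\<lambda>j. if \<exists>a\<in>A. (a, j) \<in> S then 1 else 0"] allI conjI impI)
      fix i j assume ij: "(i, j) \<in> S \<and> i \<noteq> j"
      have jA: "j \<notin> A" if "a \<in> A" "(a, i) \<in> S" for a
        using A ij that trans anti unfolding antichain_def by metis
      show "(if \<exists>a\<in>A. (a, i) \<in> S then 1 else 0) + (if j \<in> A then 1 else 0)
          \<le> (if \<exists>a\<in>A. (a, j) \<in> S then 1 else 0 :: real)"
      proof (cases "\<exists>a\<in>A. (a, i) \<in> S")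
        case True
        then have "\<exists>a\<in>A. (a, j) \<in> S" using ij trans by blast
        then show ?thesis using True jA by auto
      next
        case False
        then show ?thesis using refl by auto
      qed
    qed (use refl in auto)
  qed
  moreover have "convex {x :: real ^ 'n. chain_bounded S 1 (\<lambda>i. x $ i)}"
  proof (rule convexI)
    fix x y :: "real ^ 'n" and u v :: real
    assume "x \<in> {x. chain_bounded S 1 (\<lambda>i. x $ i)}" "y \<in> {x. chain_bounded S 1 (\<lambda>i. x $ i)}"
      and uv: "0 \<le> u" "0 \<le> v" "u + v = 1"
    then have "chain_bounded S (u * 1 + v * 1) (\<lambda>i. u * x $ i + v * y $ i)"
      by (intro chain_bounded_add chain_bounded_scale) auto
    moreover have "($) (u *\<^sub>R x + v *\<^sub>R y) = (\<lambda>i. u * x $ i + v * y $ i)"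
      by (rule ext) simp
    ultimately show "u *\<^sub>R x + v *\<^sub>R y \<in> {x. chain_bounded S 1 (\<lambda>i. x $ i)}"
      using uv by simp
  qed
  ultimately have "chain_polytope S \<subseteq> {x. chain_bounded S 1 (\<lambda>i. x $ i)}"
    unfolding chain_polytope_def by (rule hull_minimal)
  then show ?thesis using assms(2) by blast
qed

text \<open>
  For integral heights, the \<open>k\<close>-th antichain consists of those \<open>j\<close> whose interval
  \<open>[y\<^sub>j - \<bar>z\<^sub>j\<bar>, y\<^sub>j)\<close> contains \<open>k\<close>.
\<close>
lemma antichain_decomposition:
  assumes "z \<in> enriched_points S m"
  shows "\<exists>A. (\<forall>k. antichain S (A k)) \<and> (\<forall>j. \<bar>z $ j\<bar> = (\<Sum>k<m. indicator_vec (A k) $ j))"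
proof -
  define X where "X j = nat \<lfloor>\<bar>z $ j\<bar>\<rfloor>" for j
  have X: "\<bar>z $ j\<bar> = real (X j)" for j
    using assms by (auto simp: X_def enriched_points_def lattice_points_def elim!: Ints_cases dest!: spec[of _ j])
  obtain y where y: "\<bar>z $ j\<bar> \<le> y j" "y j \<le> real m"
    "(i, j) \<in> S \<Longrightarrow> i \<noteq> j \<Longrightarrow> y i + \<bar>z $ j\<bar> \<le> y j" for i j
    using assms unfolding enriched_points_def chain_bounded_def by blast
  \<comment> \<open>Rounding the heights down preserves their inequalities because every
    \<open>\<bar>z $ j\<bar>\<close> is an integer.\<close>
  define Y where "Y j = nat \<lfloor>y j\<rfloor>" for j
  have y0: "0 \<le> y j" for j using y(1)[of j] by linarith
  have Y: "X j \<le> Y j" "Y j \<le> m" for j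
    using y(1,2)[of j] y0[of j] X[of j] unfolding Y_def by linarith+
  have YY: "Y i + X j \<le> Y j" if "(i, j) \<in> S" "i \<noteq> j" for i j
    using y(3)[OF that] y0[of i] y0[of j] X[of j] unfolding Y_def by linarith
  define A where "A k = {j. Y j \<le> k + X j \<and> k < Y j}" for k
  have "antichain S (A k)" for k
    unfolding antichain_def A_def using YY by fastforce
  moreover have "\<bar>z $ j\<bar> = (\<Sum>k<m. indicator_vec (A k) $ j)" for j
  proof -
    have "(\<Sum>k<m. indicator_vec (A k) $ j) = real (card {k \<in> {..<m}. j \<in> A k})"
      by (simp add: indicator_vec_nth sum.If_cases Int_def)
    also have "{k \<in> {..<m}. j \<in> A k} = {Y j - X j..<Y j}"
      using Y[of j] by (auto simp: A_def)
    finally show ?thesis using Y(1)[of j] X by simp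
  qed
  ultimately show ?thesis by blast
qed

lemma convex_average:
  fixes v :: "nat \<Rightarrow> real ^ 'n"
  assumes "convex C" "0 < m" "\<And>k. k < m \<Longrightarrow> v k \<in> C"
  shows "(\<Sum>k<m. (1 / real m) *\<^sub>R v k) \<in> C"
  using assms by (intro convex_sum) auto

text \<open>The reverse inclusion is the integer decomposition property: the absolute values of
  \<open>z\<close> form a sum of \<open>m\<close> antichain vectors, and for positive
  \<open>m\<close> the average of these lies in the chain polytope.\<close>

lemma enriched_chain_polytope_lattice_points:
  fixes S :: "('n::finite) rel"
  assumes "partial_order_on UNIV S"
  shows "(\<lambda>x. real m *\<^sub>R x) ` enriched_chain_polytope S \<inter> lattice_points = enriched_points S m"
proof (intro equalityI subsetI)
  fix z assume z: "z \<in> (\<lambda>x. real m *\<^sub>R x) ` enriched_chain_polytope S \<inter> lattice_points"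
  then obtain \<epsilon> x where e: "\<epsilon> \<in> sign_vectors" and x: "x \<in> chain_polytope S"
    and zx: "z = real m *\<^sub>R (\<chi> i. \<epsilon> $ i * x $ i)"
    by (auto simp: enriched_chain_polytope_def)
  have st: "chain_bounded S 1 (\<lambda>i. x $ i)" by (rule chain_polytope_chain_bounded[OF assms x])
  have "\<epsilon> $ i \<in> {-1, 1}" for i using e unfolding sign_vectors_def by blast
  then have "\<bar>\<epsilon> $ i\<bar> = 1" for i by (metis abs_minus_cancel abs_one insertE singletonD)
  moreover have "0 \<le> x $ i" for i using st unfolding chain_bounded_def by blast
  ultimately have "\<bar>z $ i\<bar> = real m * x $ i" for i
    by (simp add: zx abs_mult)
  then have "chain_bounded S (real m) (\<lambda>i. \<bar>z $ i\<bar>)"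
    using chain_bounded_scale[OF st, of "real m"] by simp
  then show "z \<in> enriched_points S m"
    using z by (simp add: enriched_points_def)
next
  fix z assume z: "z \<in> enriched_points S m"
  then obtain A where A: "\<forall>k. antichain S (A k)" "\<forall>j. \<bar>z $ j\<bar> = (\<Sum>k<m. indicator_vec (A k) $ j)"
    using antichain_decomposition by blast
  define \<epsilon> :: "real ^ 'n" where "\<epsilon> = (\<chi> i. if z $ i < 0 then -1 else 1)"
  have "\<exists>x\<in>chain_polytope S. \<forall>j. \<bar>z $ j\<bar> = real m * x $ j"
  proof (cases "m = 0")
    case True
    then show ?thesis
      using A indicator_vec_in_chain_polytope[of S "{}"] by (auto simp: antichain_def)
  next
    case False
    have "(\<Sum>k<m. (1 / real m) *\<^sub>R indicator_vec (A k)) \<in> chain_polytope S"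
      using False A(1) by (intro convex_average indicator_vec_in_chain_polytope) (auto simp: chain_polytope_def)
    moreover have "\<bar>z $ j\<bar> = real m * (\<Sum>k<m. (1 / real m) *\<^sub>R indicator_vec (A k)) $ j" for j
      using A(2) False by (simp add: sum_distrib_left)
    ultimately show ?thesis by blast
  qed
  then obtain x where x: "x \<in> chain_polytope S" "\<And>j. \<bar>z $ j\<bar> = real m * x $ j" by blast
  have "z $ j = \<epsilon> $ j * \<bar>z $ j\<bar>" for j by (simp add: \<epsilon>_def)
  then have "z = real m *\<^sub>R (\<chi> i. \<epsilon> $ i * x $ i)"
    using x(2) by (simp add: vec_eq_iff mult.left_commute)
  moreover have "\<epsilon> \<in> sign_vectors" by (auto simp: \<epsilon>_def sign_vectors_def)
  ultimately show "z \<in> (\<lambda>x. real m *\<^sub>R x) ` enriched_chain_polytope S \<inter> lattice_points"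
    using z x(1) unfolding enriched_chain_polytope_def enriched_points_def by blast
qed

section \<open>Orthants of the twinned chain polytope\<close>

lemma sign_poset_iff:
  assumes "partial_order_on UNIV P" "partial_order_on UNIV Q"
  shows "(x, y) \<in> sign_poset P Q \<epsilon> \<longleftrightarrow>
      (if \<epsilon> $ x = 1 then \<epsilon> $ y = 1 \<longrightarrow> (x, y) \<in> P else \<epsilon> $ y \<noteq> 1 \<and> (x, y) \<in> Q)"
proof -
  have "(x, x) \<in> P" "(x, x) \<in> Q" for x
    using assms by (auto simp: order_on_defs refl_on_def)
  then have "Field (Restr P I) = I" "Field (Restr Q I) = I" for I
    by (fastforce simp: Field_def)+
  then show ?thesis
    by (auto simp: sign_poset_def ordinal_sum_def Let_def)
qed

text \<open>The bound \<open>t\<close> is shared between a \<open>P\<close> part and a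
  \<open>Q\<close> part. The supports of \<open>p\<close> and \<open>q\<close> may overlap, which
  keeps the condition convex.\<close>

definition twinned_chain_bounded :: "'n rel \<Rightarrow> 'n rel \<Rightarrow> real \<Rightarrow> (real ^ 'n::finite) \<Rightarrow> bool" where
  "twinned_chain_bounded P Q t x \<longleftrightarrow> (\<exists>a b p q. a + b = t \<and> 0 \<le> a \<and> 0 \<le> b \<and>
     chain_bounded P a p \<and> chain_bounded Q b q \<and> (\<forall>i. x $ i = p i - q i))"

lemma chain_bounded_0: "0 \<le> t \<Longrightarrow> chain_bounded S t (\<lambda>i. 0)"
  unfolding chain_bounded_def by (intro exI[of _ "\<lambda>_. 0"]) auto

lemma twinned_chain_polytope_chain_bounded:
  fixes P Q :: "('n::finite) rel"
  assumes "partial_order_on UNIV P" "partial_order_on UNIV Q" "x \<in> twinned_chain_polytope P Q"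
  shows "twinned_chain_bounded P Q 1 x"
proof -
  have "chain_polytope P \<union> uminus ` chain_polytope Q \<subseteq> {x. twinned_chain_bounded P Q 1 x}"
  proof clarify
    fix x assume "x \<in> chain_polytope P \<union> uminus ` chain_polytope Q"
    then show "twinned_chain_bounded P Q 1 x"
    proof
      assume "x \<in> chain_polytope P"
      then show ?thesis
        using chain_polytope_chain_bounded[OF assms(1), of x] chain_bounded_0[of 0 Q]
        unfolding twinned_chain_bounded_def
        by (intro exI[of _ 1] exI[of _ 0] exI[of _ "\<lambda>i. x $ i"] exI[of _ "\<lambda>_. 0"]) simp
    next
      assume "x \<in> uminus ` chain_polytope Q"
      then obtain q where "q \<in> chain_polytope Q" "x = - q" by blast
      then show ?thesis
        using chain_polytope_chain_bounded[OF assms(2), of q] chain_bounded_0[of 0 P]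
        unfolding twinned_chain_bounded_def
        by (intro exI[of _ 0] exI[of _ 1] exI[of _ "\<lambda>_. 0"] exI[of _ "\<lambda>i. q $ i"]) simp
    qed
  qed
  moreover have "convex {x. twinned_chain_bounded P Q 1 x}"
  proof (rule convexI)
    fix x y :: "real ^ 'n" and u v :: real
    assume "x \<in> {x. twinned_chain_bounded P Q 1 x}" "y \<in> {x. twinned_chain_bounded P Q 1 x}"
      and uv: "0 \<le> u" "0 \<le> v" "u + v = 1"
    then obtain a b p q a' b' p' q' where
      1: "a + b = 1" "0 \<le> a" "0 \<le> b" "chain_bounded P a p" "chain_bounded Q b q" "\<forall>i. x $ i = p i - q i" and
      2: "a' + b' = 1" "0 \<le> a'" "0 \<le> b'" "chain_bounded P a' p'" "chain_bounded Q b' q'" "\<forall>i. y $ i = p' i - q' i"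
      unfolding twinned_chain_bounded_def mem_Collect_eq by blast
    have "(u * a + v * a') + (u * b + v * b') = u * (a + b) + v * (a' + b')" by algebra
    also have "\<dots> = 1" using 1 2 uv by simp
    finally have "(u * a + v * a') + (u * b + v * b') = 1" .
    moreover have "chain_bounded P (u * a + v * a') (\<lambda>i. u * p i + v * p' i)"
      "chain_bounded Q (u * b + v * b') (\<lambda>i. u * q i + v * q' i)"
      using 1 2 uv by (intro chain_bounded_add chain_bounded_scale; simp)+
    moreover have "(u *\<^sub>R x + v *\<^sub>R y) $ i = (u * p i + v * p' i) - (u * q i + v * q' i)" for i
      unfolding vector_add_component vector_scaleR_component 1(6)[rule_format] 2(6)[rule_format] real_scaleR_def
      by algebra
    ultimately show "u *\<^sub>R x + v *\<^sub>R y \<in> {x. twinned_chain_bounded P Q 1 x}"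
      using 1 2 uv unfolding twinned_chain_bounded_def mem_Collect_eq
      by (intro exI[of _ "u * a + v * a'"] exI[of _ "u * b + v * b'"]
          exI[of _ "\<lambda>i. u * p i + v * p' i"] exI[of _ "\<lambda>i. u * q i + v * q' i"]) simp
  qed
  ultimately have "twinned_chain_polytope P Q \<subseteq> {x. twinned_chain_bounded P Q 1 x}"
    unfolding twinned_chain_polytope_def by (rule hull_minimal)
  then show ?thesis using assms(3) by blast
qed

lemma twinned_chain_bounded_scale:
  assumes "twinned_chain_bounded P Q t x" "0 \<le> c"
  shows "twinned_chain_bounded P Q (c * t) (c *\<^sub>R x)"
proof -
  obtain a b p q where ab: "a + b = t" "0 \<le> a" "0 \<le> b"
    and pq: "chain_bounded P a p" "chain_bounded Q b q" "\<forall>i. x $ i = p i - q i"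
    using assms(1) unfolding twinned_chain_bounded_def by blast
  show ?thesis
    unfolding twinned_chain_bounded_def
  proof (intro exI conjI)
    show "c * a + c * b = c * t" using ab(1) by (simp flip: distrib_left)
    show "chain_bounded P (c * a) (\<lambda>i. c * p i)" "chain_bounded Q (c * b) (\<lambda>i. c * q i)"
      using pq(1,2) assms(2) by (auto intro: chain_bounded_scale)
    show "\<forall>i. (c *\<^sub>R x) $ i = c * p i - c * q i"
      using pq(3) by (simp add: right_diff_distrib)
  qed (use ab assms(2) in simp_all)
qed

text \<open>Overlap of \<open>p\<close> and \<open>q\<close> does no harm: where the sign is 1, the
  absolute value is p - q, at most p, and elsewhere it is q - p, at most q.\<close>

lemma twinned_chain_bounded_sign_poset:
  fixes P Q :: "('n::finite) rel"
  assumes "partial_order_on UNIV P" "partial_order_on UNIV Q"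
    and "\<epsilon> \<in> sign_vectors" "\<And>i. 0 \<le> \<epsilon> $ i * x $ i" "twinned_chain_bounded P Q t x"
  shows "chain_bounded (sign_poset P Q \<epsilon>) t (\<lambda>i. \<bar>x $ i\<bar>)"
proof -
  obtain a b p q where ab: "a + b = t" "0 \<le> a" "0 \<le> b" and pq: "chain_bounded P a p" "chain_bounded Q b q"
    and x: "\<And>i. x $ i = p i - q i"
    using assms(5) unfolding twinned_chain_bounded_def by blast
  obtain y where y: "\<And>j. 0 \<le> p j" "\<And>j. p j \<le> y j" "\<And>j. y j \<le> a"
    "\<And>i j. (i, j) \<in> P \<Longrightarrow> i \<noteq> j \<Longrightarrow> y i + p j \<le> y j"
    using pq(1) unfolding chain_bounded_def by blast
  obtain w where w: "\<And>j. 0 \<le> q j" "\<And>j. q j \<le> w j" "\<And>j. w j \<le> b"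
    "\<And>i j. (i, j) \<in> Q \<Longrightarrow> i \<noteq> j \<Longrightarrow> w i + q j \<le> w j"
    using pq(2) unfolding chain_bounded_def by blast
  have xp: "\<bar>x $ j\<bar> \<le> p j" if "\<epsilon> $ j = 1" for j
    using assms(4)[of j] that x[of j] w(1)[of j] by simp
  have xq: "\<bar>x $ j\<bar> \<le> q j" if "\<epsilon> $ j \<noteq> 1" for j
  proof -
    have "\<epsilon> $ j = -1" using assms(3) that by (auto simp: sign_vectors_def)
    then show ?thesis using assms(4)[of j] x[of j] y(1)[of j] by simp
  qed
  show ?thesis
    unfolding chain_bounded_def
  \<comment> \<open>The \<open>Q\<close> part lies above the whole \<open>P\<close> part, whose
    heights are at most \<open>a\<close>; hence the shift by \<open>a\<close>.\<close>
  proof (intro exI[of _ "\<lambda>j. if \<epsilon> $ j = 1 then y j else a + w j"] allI conjI impI)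
    fix j
    show "\<bar>x $ j\<bar> \<le> (if \<epsilon> $ j = 1 then y j else a + w j)"
      using xp[of j] xq[of j] y(2)[of j] w(2)[of j] ab by auto
    show "(if \<epsilon> $ j = 1 then y j else a + w j) \<le> t"
      using y(3)[of j] w(3)[of j] ab by auto
    fix i assume ij: "(i, j) \<in> sign_poset P Q \<epsilon> \<and> i \<noteq> j"
    then show "(if \<epsilon> $ i = 1 then y i else a + w i) + \<bar>x $ j\<bar> \<le> (if \<epsilon> $ j = 1 then y j else a + w j)"
      using xp[of j] xq[of j] y(3)[of i] y(4)[of i j] w(2)[of j] w(4)[of i j]
      unfolding sign_poset_iff[OF assms(1,2)] by (auto split: if_splits)
  qed simp
qed

text \<open>Zero coordinates of \<open>z\<close> leave \<open>\<epsilon>\<close> free, and the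
  description is valid for every compatible choice.\<close>

lemma twinned_chain_polytope_lattice_points:
  fixes P Q :: "('n::finite) rel"
  assumes "partial_order_on UNIV P" "partial_order_on UNIV Q"
    and "\<epsilon> \<in> sign_vectors" "\<And>i. 0 \<le> \<epsilon> $ i * z $ i"
  shows "z \<in> (\<lambda>x. real m *\<^sub>R x) ` twinned_chain_polytope P Q \<inter> lattice_points \<longleftrightarrow>
    z \<in> enriched_points (sign_poset P Q \<epsilon>) m"
proof
  assume z: "z \<in> (\<lambda>x. real m *\<^sub>R x) ` twinned_chain_polytope P Q \<inter> lattice_points"
  then obtain x where "x \<in> twinned_chain_polytope P Q" "z = real m *\<^sub>R x" by blast
  then have "twinned_chain_bounded P Q (real m) z"
    using twinned_chain_bounded_scale[OF twinned_chain_polytope_chain_bounded[OF assms(1,2)], of x "real m"] by simp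
  then show "z \<in> enriched_points (sign_poset P Q \<epsilon>) m"
    using z twinned_chain_bounded_sign_poset[OF assms] by (simp add: enriched_points_def)
next
  assume z: "z \<in> enriched_points (sign_poset P Q \<epsilon>) m"
  then obtain A where A: "\<And>k. antichain (sign_poset P Q \<epsilon>) (A k)"
    "\<And>j. \<bar>z $ j\<bar> = (\<Sum>k<m. indicator_vec (A k) $ j)"
    using antichain_decomposition by metis
  have e: "\<epsilon> $ i = 1 \<or> \<epsilon> $ i = -1" for i using assms(3) by (auto simp: sign_vectors_def)
  define v :: "nat \<Rightarrow> real ^ 'n" where "v k = (\<chi> j. \<epsilon> $ j * indicator_vec (A k) $ j)" for k
  \<comment> \<open>Elements of different sign are comparable in the ordinal sum, so one element of
    sign 1 forces this sign on the whole antichain. All others, including the empty one, are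
    antichains of \<open>Q\<close>.\<close>
  have v: "v k \<in> chain_polytope P \<union> uminus ` chain_polytope Q" for k
  proof (cases "\<exists>i\<in>A k. \<epsilon> $ i = 1")
    case True
    then have "\<epsilon> $ i = 1" if "i \<in> A k" for i
      using A(1)[of k] that unfolding antichain_def sign_poset_iff[OF assms(1,2)] by metis
    then have "antichain P (A k)" "v k = indicator_vec (A k)"
      using A(1)[of k] unfolding antichain_def sign_poset_iff[OF assms(1,2)] v_def
      by (auto simp: vec_eq_iff indicator_vec_nth)
    then show ?thesis by (simp add: indicator_vec_in_chain_polytope)
  next
    case False
    then have "antichain Q (A k)" "v k = - indicator_vec (A k)"
      using A(1)[of k] e unfolding antichain_def sign_poset_iff[OF assms(1,2)] v_def
      by (auto simp: vec_eq_iff indicator_vec_nth)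
    then show ?thesis by (simp add: indicator_vec_in_chain_polytope)
  qed
  have zv: "z $ j = (\<Sum>k<m. v k $ j)" for j
  proof -
    have "z $ j = \<epsilon> $ j * \<bar>z $ j\<bar>" using e[of j] assms(4)[of j] by auto
    then show ?thesis using A(2)[of j] by (simp add: v_def sum_distrib_left)
  qed
  have "\<exists>x\<in>twinned_chain_polytope P Q. z = real m *\<^sub>R x"
  proof (cases "m = 0")
    case True
    then have "z = 0" using zv by (simp add: vec_eq_iff)
    moreover have "v 0 \<in> twinned_chain_polytope P Q"
      unfolding twinned_chain_polytope_def by (rule hull_inc[OF v])
    ultimately show ?thesis using True by auto
  next
    case False
    have "(\<Sum>k<m. (1 / real m) *\<^sub>R v k) \<in> twinned_chain_polytope P Q"
      unfolding twinned_chain_polytope_def using False by (intro convex_average hull_inc[OF v]) auto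
    moreover have "z = real m *\<^sub>R (\<Sum>k<m. (1 / real m) *\<^sub>R v k)"
      using zv False by (simp add: vec_eq_iff sum_distrib_left)
    ultimately show ?thesis by blast
  qed
  then show "z \<in> (\<lambda>x. real m *\<^sub>R x) ` twinned_chain_polytope P Q \<inter> lattice_points"
    using z by (auto simp: enriched_points_def)
qed

section \<open>Ehrhart series\<close>

lemma bij_betw_sign_vectors:
  "bij_betw (\<lambda>I. \<chi> i. if i \<in> I then 1 else -1) (UNIV :: 'n set set) (sign_vectors :: (real ^ 'n::finite) set)"
proof (rule bij_betw_byWitness[of _ "\<lambda>\<epsilon>. {i. \<epsilon> $ i = 1}"])
  have "(if \<epsilon> $ i = 1 then 1 else -1) = \<epsilon> $ i" if "\<epsilon> \<in> sign_vectors" for \<epsilon> :: "real ^ 'n" and i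
    using that by (auto simp: sign_vectors_def dest: spec[of _ i])
  then show "\<forall>\<epsilon>\<in>sign_vectors. (\<chi> i. if i \<in> {i. \<epsilon> $ i = 1} then 1 else -1) = (\<epsilon> :: real ^ 'n)"
    by (simp add: vec_eq_iff)
qed (auto simp: sign_vectors_def)

lemma card_sign_vectors: "card (sign_vectors :: (real ^ 'n::finite) set) = 2 ^ CARD('n)"
  using bij_betw_same_card[OF bij_betw_sign_vectors] card_Pow[of "UNIV :: 'n set"]
  by (metis Pow_UNIV finite)

lemma finite_sign_vectors: "finite (sign_vectors :: (real ^ 'n::finite) set)"
  using card_sign_vectors[where 'n = 'n] by (intro card_ge_0_finite) simp

text \<open>At a zero coordinate \<open>z\<close> records no sign, so \<open>\<epsilon>\<close>
  keeps its entry there. This is what makes the map self-inverse.\<close>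

definition swap_signs :: "(real ^ 'n) \<times> (real ^ 'n) \<Rightarrow> (real ^ 'n) \<times> (real ^ 'n::finite)" where
  "swap_signs = (\<lambda>(\<epsilon>, z). ((\<chi> i. if z $ i = 0 then \<epsilon> $ i else sgn (z $ i)), (\<chi> i. \<epsilon> $ i * \<bar>z $ i\<bar>)))"

lemma swap_signs_swap_signs:
  assumes "\<epsilon> \<in> sign_vectors"
  shows "swap_signs (swap_signs (\<epsilon>, z)) = (\<epsilon>, z)"
proof -
  have e: "\<epsilon> $ i = 1 \<or> \<epsilon> $ i = -1" for i using assms by (auto simp: sign_vectors_def)
  have "(if \<epsilon> $ i * \<bar>z $ i\<bar> = 0 then (if z $ i = 0 then \<epsilon> $ i else sgn (z $ i)) else sgn (\<epsilon> $ i * \<bar>z $ i\<bar>)) = \<epsilon> $ i"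
    for i using e[of i] by (auto simp: sgn_if)
  moreover have "(if z $ i = 0 then \<epsilon> $ i else sgn (z $ i)) * \<bar>\<epsilon> $ i * \<bar>z $ i\<bar>\<bar> = z $ i" for i
    using e[of i] by (auto simp: sgn_if)
  ultimately show ?thesis
    unfolding swap_signs_def prod.case vec_lambda_beta by (simp only: vec_lambda_eta)
qed

lemma sum_card_enriched_points:
  fixes P Q :: "('n::finite) rel" and m :: nat
  assumes "partial_order_on UNIV P" "partial_order_on UNIV Q"
  defines "T \<equiv> (\<lambda>x. real m *\<^sub>R x) ` twinned_chain_polytope P Q \<inter> lattice_points"
  shows "(\<Sum>\<epsilon>\<in>sign_vectors. card (enriched_points (sign_poset P Q \<epsilon>) m)) = 2 ^ CARD('n) * card T"
proof -
  have fin: "finite (enriched_points (sign_poset P Q \<epsilon>) m)" for \<epsilon> :: "real ^ 'n"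
    using bij_betw_finite[OF bij_betw_signed_heights[OF partial_order_on_sign_poset[OF assms(1,2)]]]
      finite_enriched_partitions by blast
  let ?A = "SIGMA \<epsilon>:sign_vectors. enriched_points (sign_poset P Q \<epsilon>) m"
  have abs: "enriched_points S m = {z \<in> lattice_points. chain_bounded S (real m) (\<lambda>i. \<bar>z $ i\<bar>)}" for S :: "'n rel"
    by (simp add: enriched_points_def)
  have sv: "\<bar>\<epsilon> $ i\<bar> = 1" "\<epsilon> $ i \<in> \<int>" if "\<epsilon> \<in> sign_vectors" for \<epsilon> :: "real ^ 'n" and i
  proof -
    have "\<epsilon> $ i = -1 \<or> \<epsilon> $ i = 1" using that by (auto simp: sign_vectors_def)
    then show "\<bar>\<epsilon> $ i\<bar> = 1" "\<epsilon> $ i \<in> \<int>" by auto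
  qed
  have lat: "(\<chi> i. \<epsilon> $ i * \<bar>z $ i\<bar>) \<in> lattice_points" if "\<epsilon> \<in> sign_vectors" "z \<in> lattice_points"
    for \<epsilon> z :: "real ^ 'n"
    using that sv unfolding lattice_points_def by (simp add: Ints_mult)
  have ab: "\<bar>(\<chi> i. \<epsilon> $ i * \<bar>z $ i\<bar>) $ i\<bar> = \<bar>z $ i\<bar>" if "\<epsilon> \<in> sign_vectors" for \<epsilon> z :: "real ^ 'n" and i
    using sv(1)[OF that] by (simp add: abs_mult)
  have sgnv: "(\<chi> i. if z $ i = 0 then \<epsilon> $ i else sgn (z $ i)) \<in> sign_vectors" if "\<epsilon> \<in> sign_vectors"
    for \<epsilon> z :: "real ^ 'n"
    using that by (auto simp: sign_vectors_def sgn_if)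
  have "bij_betw swap_signs ?A (sign_vectors \<times> T)"
  proof (rule bij_betw_byWitness[of _ swap_signs])
    show "swap_signs ` ?A \<subseteq> sign_vectors \<times> T"
    proof (rule image_subsetI, elim SigmaE)
      fix p \<epsilon> and z :: "real ^ 'n"
      assume e: "\<epsilon> \<in> sign_vectors" and z: "z \<in> enriched_points (sign_poset P Q \<epsilon>) m" and p: "p = (\<epsilon>, z)"
      let ?x = "\<chi> i. \<epsilon> $ i * \<bar>z $ i\<bar>"
      \<comment> \<open>Membership depends on absolute values, so the signs of \<open>z\<close> may
        be replaced by \<open>\<epsilon>\<close>, which moves the point into the orthant described
        by this sign poset.\<close>
      have "?x \<in> enriched_points (sign_poset P Q \<epsilon>) m"
        using z lat[OF e] unfolding abs mem_Collect_eq ab[OF e] by blast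
      moreover have "0 \<le> \<epsilon> $ i * ?x $ i" for i
        by (simp flip: mult.assoc)
      ultimately have "?x \<in> T"
        unfolding T_def using twinned_chain_polytope_lattice_points[OF assms(1,2) e, of ?x m] by blast
      then show "swap_signs p \<in> sign_vectors \<times> T"
        using sgnv[OF e] by (simp add: p swap_signs_def)
    qed
    show "swap_signs ` (sign_vectors \<times> T) \<subseteq> ?A"
    proof (rule image_subsetI, elim SigmaE)
      fix p and \<delta> x :: "real ^ 'n"
      assume d: "\<delta> \<in> sign_vectors" and x: "x \<in> T" and p: "p = (\<delta>, x)"
      let ?e = "\<chi> i. if x $ i = 0 then \<delta> $ i else sgn (x $ i)"
      have "0 \<le> ?e $ i * x $ i" for i by (simp add: sgn_if)
      then have "x \<in> enriched_points (sign_poset P Q ?e) m"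
        using x twinned_chain_polytope_lattice_points[OF assms(1,2) sgnv[OF d], of x x m]
        unfolding T_def by blast
      then have "(\<chi> i. \<delta> $ i * \<bar>x $ i\<bar>) \<in> enriched_points (sign_poset P Q ?e) m"
        using lat[OF d] unfolding abs mem_Collect_eq ab[OF d] by blast
      then show "swap_signs p \<in> ?A"
        using sgnv[OF d] by (simp add: p swap_signs_def)
    qed
  qed (auto simp: swap_signs_swap_signs)
  then have "card ?A = card ((sign_vectors :: (real ^ 'n) set) \<times> T)" by (rule bij_betw_same_card)
  moreover have "card ?A = (\<Sum>\<epsilon>\<in>sign_vectors. card (enriched_points (sign_poset P Q \<epsilon>) m))"
    using finite_sign_vectors fin by (intro card_SigmaI) blast+
  ultimately show ?thesis by (simp add: card_cartesian_product card_sign_vectors)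
qed

text \<open>\<open>ehrhart_series\<close> fixes its constant term as 1; the count agrees with this
  convention.\<close>

lemma card_enriched_points_0: "card (enriched_points S 0) = 1"
proof -
  have "enriched_points S 0 = {0}"
  proof (intro equalityI subsetI)
    fix z assume "z \<in> enriched_points S 0"
    then obtain y where "\<And>j. \<bar>z $ j\<bar> \<le> y j \<and> y j \<le> 0"
      unfolding enriched_points_def chain_bounded_def by auto
    then have "z $ j = 0" for j by (meson abs_le_zero_iff order_trans)
    then show "z \<in> {0}" by (simp add: vec_eq_iff)
  next
    fix z :: "real ^ 'a" assume "z \<in> {0}"
    then show "z \<in> enriched_points S 0"
      using chain_bounded_0[of 0 S] by (simp add: enriched_points_def lattice_points_def)
  qed
  then show ?thesis by simp
qed

lemma ehrhart_series_enriched: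
  fixes S :: "('n::finite) rel"
  assumes "partial_order_on UNIV S"
  shows "ehrhart_series (enriched_chain_polytope S) = Abs_fps (\<lambda>m. real (card (enriched_points S m)))"
  unfolding ehrhart_series_def enriched_chain_polytope_lattice_points[OF assms]
  by (rule fps_ext) (simp add: card_enriched_points_0)

lemma ehrhart_series_twinned:
  fixes P Q :: "('n::finite) rel"
  assumes "partial_order_on UNIV P" "partial_order_on UNIV Q"
  shows "ehrhart_series (twinned_chain_polytope P Q) =
    fps_const (1 / 2 ^ CARD('n)) * (\<Sum>\<epsilon>\<in>sign_vectors. ehrhart_series (enriched_chain_polytope (sign_poset P Q \<epsilon>)))"
proof (rule fps_ext)
  fix m
  let ?T = "(\<lambda>x. real m *\<^sub>R x) ` twinned_chain_polytope P Q \<inter> lattice_points"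
  have "real (\<Sum>\<epsilon>\<in>(sign_vectors :: (real ^ 'n) set). card (enriched_points (sign_poset P Q \<epsilon>) m)) = 2 ^ CARD('n) * real (card ?T)"
    unfolding sum_card_enriched_points[OF assms] by simp
  then have "real (card ?T) = (1 / 2 ^ CARD('n)) * (\<Sum>\<epsilon>\<in>(sign_vectors :: (real ^ 'n) set). real (card (enriched_points (sign_poset P Q \<epsilon>) m)))"
    by (simp add: field_simps)
  moreover have "(\<Sum>\<epsilon>\<in>(sign_vectors :: (real ^ 'n) set). real (card (enriched_points (sign_poset P Q \<epsilon>) 0))) = 2 ^ CARD('n)"
    by (simp add: card_enriched_points_0 card_sign_vectors)
  ultimately show "fps_nth (ehrhart_series (twinned_chain_polytope P Q)) m =
    fps_nth (fps_const (1 / 2 ^ CARD('n)) * (\<Sum>\<epsilon>\<in>sign_vectors. ehrhart_series (enriched_chain_polytope (sign_poset P Q \<epsilon>)))) m"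
    unfolding ehrhart_series_enriched[OF partial_order_on_sign_poset[OF assms]]
    by (auto simp: ehrhart_series_def fps_sum_nth)
qed

section \<open>The h*-polynomials of enriched chain polytopes\<close>

lemma hstar_eqI: "fps_of_poly h = ehrhart_series S * (1 - fps_X) ^ (CARD('n) + 1) \<Longrightarrow> hstar (S :: (real ^ 'n::finite) set) = h"
  unfolding hstar_def by (rule the_equality) (auto simp flip: fps_of_poly_eq_iff)

text \<open>For \<open>2 * k \<le> d\<close> this is (1+x)^d (4x/(1+x)^2)^k with denominators
  cleared, hence also meaningful at x = -1.\<close>

definition gamma_basis :: "nat \<Rightarrow> nat \<Rightarrow> real poly" where
  "gamma_basis d k = monom (4 ^ k) k * [:1, 1:] ^ (d - 2 * k)"

lemma fps_of_poly_gamma_basis: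
  "fps_of_poly (gamma_basis d k) = (4 * fps_X) ^ k * (1 + fps_X) ^ (d - 2 * k)"
proof -
  have "fps_of_poly (monom (4 ^ k) k) = (4 * fps_X :: real fps) ^ k"
    by (simp add: fps_of_poly_monom power_mult_distrib numeral_fps_const fps_const_power)
  moreover have "fps_of_poly [:1, 1:] = (1 + fps_X :: real fps)"
    by (simp add: fps_of_poly_pCons)
  ultimately show ?thesis
    unfolding gamma_basis_def fps_of_poly_mult fps_of_poly_power by simp
qed

lemma length_linear_extension:
  fixes R :: "('n::{finite,linorder}) rel"
  assumes "\<pi> \<in> linear_extensions R"
  shows "distinct \<pi>" "\<pi> \<noteq> []" "length \<pi> = CARD('n)"
  using assms by (auto simp: linear_extensions_def permutations_of_set_def distinct_card[symmetric])

lemma fps_of_poly_hstar_enriched: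
  fixes R :: "('n::{finite,linorder}) rel"
  assumes "partial_order_on UNIV R" "naturally_labeled R"
  shows "fps_of_poly (\<Sum>\<pi>\<in>linear_extensions R. gamma_basis CARD('n) (left_peaks \<pi>)) =
    Abs_fps (\<lambda>m. real (card (enriched_points R m))) * (1 - fps_X) ^ (CARD('n) + 1)"
proof -
  have "card (enriched_points R m) = (\<Sum>\<pi>\<in>linear_extensions R. card (sorted_words \<pi> (2 * m + 1)))" for m
    using bij_betw_same_card[OF bij_betw_signed_heights[OF assms(1), of m]]
      card_enriched_partitions[OF assms(2), of "2 * m + 1"] by simp
  then have "Abs_fps (\<lambda>m. real (card (enriched_points R m))) = (\<Sum>\<pi>\<in>linear_extensions R. even_gf \<pi>)"
    by (intro fps_ext) (simp add: fps_sum_nth even_gf_def)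
  moreover have "even_gf \<pi> * (1 - fps_X) ^ (CARD('n) + 1) = fps_of_poly (gamma_basis CARD('n) (left_peaks \<pi>))"
    if "\<pi> \<in> linear_extensions R" for \<pi>
    using even_gf_left_peaks(2)[OF length_linear_extension(1,2)[OF that]] length_linear_extension(3)[OF that]
    unfolding fps_of_poly_gamma_basis by (metis mult.commute)
  ultimately show ?thesis
    by (simp add: sum_distrib_right fps_of_poly_sum)
qed

lemma partial_order_relabeling:
  assumes "partial_order_on UNIV S" "relabeling_of S R"
  shows "partial_order_on UNIV R"
proof -
  obtain \<sigma> where \<sigma>: "bij \<sigma>" and R: "R = map_prod \<sigma> \<sigma> ` S"
    using assms(2) unfolding relabeling_of_def by blast
  have iff: "(x, y) \<in> R \<longleftrightarrow> (inv \<sigma> x, inv \<sigma> y) \<in> S" for x y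
  proof
    assume "(x, y) \<in> R"
    then show "(inv \<sigma> x, inv \<sigma> y) \<in> S" using \<sigma> by (auto simp: R bij_is_inj)
  next
    assume "(inv \<sigma> x, inv \<sigma> y) \<in> S"
    then have "map_prod \<sigma> \<sigma> (inv \<sigma> x, inv \<sigma> y) \<in> R" unfolding R by (rule imageI)
    then show "(x, y) \<in> R" using \<sigma> by (simp add: bij_is_surj surj_f_inv_f)
  qed
  have inj: "inj (inv \<sigma>)" using \<sigma> by (simp add: bij_imp_bij_inv bij_is_inj)
  have S: "refl S" "trans S" "antisym S" using assms(1) by (auto simp: order_on_defs)
  have "refl R" using S(1) unfolding refl_on_def iff by blast
  moreover have "trans R" using S(2) unfolding trans_def iff by blast
  moreover have "antisym R"
  proof (rule antisymI)
    fix x y assume "(x, y) \<in> R" "(y, x) \<in> R"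
    then have "inv \<sigma> x = inv \<sigma> y" using S(3) unfolding iff antisym_def by blast
    then show "x = y" by (rule injD[OF inj])
  qed
  ultimately show ?thesis by (simp add: order_on_defs)
qed

lemma ehrhart_series_relabeling:
  fixes S R :: "('n::finite) rel"
  assumes "partial_order_on UNIV S" "relabeling_of S R"
  shows "ehrhart_series (enriched_chain_polytope R) = ehrhart_series (enriched_chain_polytope S)"
proof -
  obtain \<sigma> where "bij \<sigma>" "R = map_prod \<sigma> \<sigma> ` S"
    using assms(2) unfolding relabeling_of_def by blast
  then show ?thesis
    unfolding ehrhart_series_enriched[OF assms(1)] ehrhart_series_enriched[OF partial_order_relabeling[OF assms]]
    by (simp add: card_enriched_points_relabel)
qed

section \<open>Gamma expansions\<close>

text \<open>The target is an arbitrary real field, so that one evaluation formula serves real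
  arguments for the symmetry and complex ones for real-rootedness.\<close>

lemma map_poly_of_real_mult:
  fixes p q :: "real poly"
  shows "map_poly (of_real :: real \<Rightarrow> 'a::real_field) (p * q) = map_poly of_real p * map_poly of_real q"
  by (rule poly_eqI) (simp add: coeff_map_poly coeff_mult)

lemma map_poly_of_real_power:
  fixes p :: "real poly"
  shows "map_poly (of_real :: real \<Rightarrow> 'a::real_field) (p ^ n) = map_poly of_real p ^ n"
  by (induction n) (simp_all add: map_poly_of_real_mult)

lemma map_poly_of_real_sum:
  fixes p :: "'b \<Rightarrow> real poly"
  shows "map_poly (of_real :: real \<Rightarrow> 'a::real_field) (sum p A) = (\<Sum>i\<in>A. map_poly of_real (p i))"
  by (rule poly_eqI) (simp add: coeff_map_poly coeff_sum)

lemma poly_map_poly_of_real_gamma_basis: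
  "poly (map_poly of_real (gamma_basis d k)) z = (4 * z) ^ k * (1 + z) ^ (d - 2 * k)"
    for z :: "'a::real_field"
  unfolding gamma_basis_def map_poly_of_real_mult map_poly_of_real_power
  by (simp add: map_poly_monom map_poly_pCons poly_monom power_mult_distrib)

lemma poly_map_poly_of_real_altdef:
  fixes z :: "'a::real_field"
  assumes "degree f \<le> n"
  shows "poly (map_poly of_real f) z = (\<Sum>k\<le>n. of_real (coeff f k) * z ^ k)"
proof -
  have "poly (map_poly of_real f) z = (\<Sum>k\<le>degree f. of_real (coeff f k) * z ^ k)"
    by (simp add: poly_altdef coeff_map_poly degree_map_poly)
  also have "\<dots> = (\<Sum>k\<le>n. of_real (coeff f k) * z ^ k)"
    using assms by (intro sum.mono_neutral_left) (auto simp: coeff_eq_0)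
  finally show ?thesis .
qed

text \<open>The polynomial form of (x+1)^d f(4x/(x+1)^2), faithful for degree of \<open>f\<close> at
  most \<open>d div 2\<close>.\<close>

definition gamma_expansion :: "nat \<Rightarrow> real poly \<Rightarrow> real poly" where
  "gamma_expansion d f = (\<Sum>k\<le>d div 2. smult (coeff f k) (gamma_basis d k))"

lemma gamma_expansion_smult: "gamma_expansion d (smult c f) = smult c (gamma_expansion d f)"
proof -
  have "smult c (sum g A) = (\<Sum>k\<in>A. smult c (g k))" for g :: "nat \<Rightarrow> real poly" and A
    by (induction A rule: infinite_finite_induct) (simp_all add: smult_add_right)
  then show ?thesis by (simp add: gamma_expansion_def)
qed

lemma gamma_expansion_sum: "gamma_expansion d (sum f A) = (\<Sum>a\<in>A. gamma_expansion d (f a))"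
  unfolding gamma_expansion_def coeff_sum smult_sum by (rule sum.swap)

lemma gamma_expansion_monom:
  assumes "2 * k \<le> d"
  shows "gamma_expansion d (monom 1 k) = gamma_basis d k"
proof -
  have "gamma_expansion d (monom 1 k) = (\<Sum>j\<le>d div 2. if j = k then gamma_basis d k else 0)"
    unfolding gamma_expansion_def by (intro sum.cong) auto
  also have "\<dots> = gamma_basis d k" using assms by simp
  finally show ?thesis .
qed

lemma poly_gamma_expansion:
  fixes z :: "'a::real_field"
  shows "poly (map_poly of_real (gamma_expansion d f)) z =
    (\<Sum>k\<le>d div 2. of_real (coeff f k) * ((4 * z) ^ k * (1 + z) ^ (d - 2 * k)))"
  unfolding gamma_expansion_def map_poly_of_real_sum poly_sum
  by (simp add: map_poly_smult poly_map_poly_of_real_gamma_basis)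

lemma poly_gamma_expansion_eq:
  fixes z :: "'a::real_field"
  assumes "degree f \<le> d div 2" "z \<noteq> -1"
  shows "poly (map_poly of_real (gamma_expansion d f)) z =
    (z + 1) ^ d * poly (map_poly of_real f) (4 * z / (z + 1)\<^sup>2)"
  unfolding poly_gamma_expansion poly_map_poly_of_real_altdef[OF assms(1)] sum_distrib_left
proof (intro sum.cong refl)
  fix k assume "k \<in> {..d div 2}"
  then have "d = 2 * k + (d - 2 * k)" by simp
  then have "(z + 1) ^ d = ((z + 1)\<^sup>2) ^ k * (z + 1) ^ (d - 2 * k)"
    by (metis power_add power_mult)
  moreover have "(z + 1)\<^sup>2 \<noteq> 0"
    using assms(2) by (simp add: add_eq_0_iff2)
  then have "((z + 1)\<^sup>2) ^ k * (4 * z / (z + 1)\<^sup>2) ^ k = (4 * z) ^ k"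
    unfolding power_mult_distrib[symmetric] by simp
  \<comment> \<open>The powers are abstracted to variables, as their exponents are symbolic.\<close>
  moreover have "c * (B * E) = A * (c * D)" if "A = C * E" "C * D = B" for c A B C D E :: 'a
    using that by algebra
  ultimately show "of_real (coeff f k) * ((4 * z) ^ k * (1 + z) ^ (d - 2 * k)) =
      (z + 1) ^ d * (of_real (coeff f k) * (4 * z / (z + 1)\<^sup>2) ^ k)"
    unfolding add.commute[of 1 z] by blast
qed

lemma degree_gamma_basis: "degree (gamma_basis d k) \<le> d - k" if "2 * k \<le> d"
proof -
  have "degree (gamma_basis d k) \<le> degree (monom (4 ^ k :: real) k) + degree ([:1, 1:] ^ (d - 2 * k) :: real poly)"
    unfolding gamma_basis_def by (rule degree_mult_le)
  also have "\<dots> \<le> k + (d - 2 * k)"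
    using degree_power_le[of "[:1, 1:] :: real poly" "d - 2 * k"] degree_monom_le[of "4 ^ k :: real" k]
    by simp
  finally show ?thesis using that by simp
qed

text \<open>Only the summand for k = 0, a multiple of (1+x)^d, reaches degree \<open>d\<close>; the
  k-th has degree at most d - k.\<close>

lemma degree_gamma_expansion:
  assumes "coeff f 0 \<noteq> 0"
  shows "degree (gamma_expansion d f) = d"
proof (rule antisym)
  show "degree (gamma_expansion d f) \<le> d"
    unfolding gamma_expansion_def
    by (intro degree_sum_le) (auto intro!: order_trans[OF degree_smult_le] order_trans[OF degree_gamma_basis])
  have "coeff (gamma_basis d k) d = (if k = 0 then 1 else 0)" if "k \<le> d div 2" for k
  proof (cases "k = 0")
    case True
    have "degree ([:1, 1:] ^ d :: real poly) = d" by (simp add: degree_power_eq)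
    then have "coeff ([:1, 1:] ^ d :: real poly) d = 1"
      using lead_coeff_power[of "[:1, 1:] :: real poly" d] by simp
    then show ?thesis using True by (simp add: gamma_basis_def)
  next
    case False
    then have "degree (gamma_basis d k) < d" using that degree_gamma_basis[of k d] by linarith
    then show ?thesis using False by (simp add: coeff_eq_0)
  qed
  then have "coeff (gamma_expansion d f) d = (\<Sum>k\<le>d div 2. if k = 0 then coeff f 0 else 0)"
    unfolding gamma_expansion_def coeff_sum by (intro sum.cong) auto
  also have "\<dots> = coeff f 0" by simp
  finally show "d \<le> degree (gamma_expansion d f)"
    using assms by (intro le_degree) simp
qed

lemma map_poly_of_real_id: "map_poly of_real (p :: real poly) = p"
  by (rule poly_eqI) (simp add: coeff_map_poly)

text \<open>Each summand is symmetric about d/2. As \<open>reflect_poly\<close> uses the actual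
  degree, this degree must be exactly \<open>d\<close>, which the nonzero constant term of
  \<open>f\<close> ensures.\<close>

lemma gamma_positive_gamma_expansion:
  assumes "\<And>k. 0 \<le> coeff f k" "coeff f 0 \<noteq> 0"
  shows "gamma_positive (gamma_expansion d f)"
proof -
  let ?h = "gamma_expansion d f"
  note deg = degree_gamma_expansion[OF assms(2), of d]
  have h: "poly ?h z = (\<Sum>k\<le>d div 2. coeff f k * ((4 * z) ^ k * (1 + z) ^ (d - 2 * k)))" for z
    using poly_gamma_expansion[of d f z] by (simp add: map_poly_of_real_id)
  have "poly (reflect_poly ?h) z = poly ?h z" if "z \<noteq> 0" for z
  proof -
    have "poly (reflect_poly ?h) z = z ^ d * poly ?h (1 / z)"
      using poly_reflect_poly_nz[OF that, of ?h] by (simp add: deg inverse_eq_divide)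
    also have "\<dots> = poly ?h z"
      unfolding h sum_distrib_left
    proof (intro sum.cong refl)
      fix k assume "k \<in> {..d div 2}"
      then have "d = k + k + (d - 2 * k)" by simp
      then have "z ^ d = z ^ k * z ^ k * z ^ (d - 2 * k)"
        by (metis power_add)
      moreover have "z ^ (d - 2 * k) * (1 + 1 / z) ^ (d - 2 * k) = (1 + z) ^ (d - 2 * k)"
        using that by (simp flip: power_mult_distrib add: distrib_left add.commute)
      moreover have "z ^ k * (4 * (1 / z)) ^ k = 4 ^ k"
        using that by (simp flip: power_mult_distrib)
      moreover have "A * (c * (G * E)) = c * (H * B * F)"
        if "A = B * B * D" "D * E = F" "B * G = H" for A B D E F G H c :: real
        using that by algebra
      ultimately show "z ^ d * (coeff f k * ((4 * (1 / z)) ^ k * (1 + 1 / z) ^ (d - 2 * k))) =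
          coeff f k * ((4 * z) ^ k * (1 + z) ^ (d - 2 * k))"
        unfolding power_mult_distrib[of 4 z] by blast
    qed
    finally show ?thesis .
  qed
  \<comment> \<open>The two polynomials agree at every nonzero real, so their difference has
    infinitely many roots.\<close>
  then have "UNIV \<subseteq> insert 0 {z. poly (reflect_poly ?h - ?h) z = 0}" by auto
  then have "\<not> finite {z. poly (reflect_poly ?h - ?h) z = 0}"
    using infinite_UNIV_char_0[where 'a = real] finite_subset by blast
  then have "reflect_poly ?h - ?h = 0"
    using poly_roots_finite by blast
  moreover have "?h = (\<Sum>k\<le>degree ?h div 2. monom (coeff f k * 4 ^ k) k * [:1, 1:] ^ (degree ?h - 2 * k))"
    unfolding deg unfolding gamma_expansion_def gamma_basis_def
    by (intro sum.cong refl) (simp flip: smult_monom mult_smult_left)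
  ultimately show ?thesis
    unfolding gamma_positive_def using assms(1)
    by (intro conjI exI[of _ "\<lambda>k. coeff f k * 4 ^ k"]) simp_all
qed

text \<open>
  A root \<open>y\<close> of \<open>f\<close> corresponds to the roots of \<open>z\<^sup>2 + 2bz + 1\<close> with \<open>b = 1 - 2/y\<close>. Real roots of \<open>f\<close> are
  negative, and then \<open>b > 1\<close> makes the discriminant positive.
\<close>
lemma real_rooted_gamma_expansion:
  assumes "degree f \<le> d div 2" "\<And>k. 0 \<le> coeff f k" "coeff f 0 \<noteq> 0"
  shows "real_rooted (gamma_expansion d f) \<longleftrightarrow> real_rooted f"
proof
  assume h: "real_rooted (gamma_expansion d f)"
  show "real_rooted f"
    unfolding real_rooted_def
  proof (intro allI impI)
    fix y :: complex assume y: "poly (map_poly of_real f) y = 0"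
    have "y \<noteq> 0" using y assms(3) by (auto simp: poly_0_coeff_0 coeff_map_poly)
    define b where "b = 1 - 2 / y"
    define z where "z = csqrt (b\<^sup>2 - 1) - b"
    have "z\<^sup>2 + 2 * b * z + 1 = (csqrt (b\<^sup>2 - 1))\<^sup>2 - b\<^sup>2 + 1"
      unfolding z_def by algebra
    then have 0: "z\<^sup>2 + 2 * b * z + 1 = 0" by simp
    have bz: "b * y = y - 2" using \<open>y \<noteq> 0\<close> by (simp add: b_def left_diff_distrib)
    have yz: "y * (z + 1)\<^sup>2 = 4 * z" using 0 bz by algebra
    \<comment> \<open>At z = -1 the equation \<open>yz\<close> would read 0 = -4.\<close>
    then have z: "z \<noteq> -1" by auto
    then have "(z + 1)\<^sup>2 \<noteq> 0" by (simp add: add_eq_0_iff2)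
    then have yeq: "y = 4 * z / (z + 1)\<^sup>2" using yz by (simp add: field_simps)
    have "poly (map_poly of_real (gamma_expansion d f)) z = 0"
      unfolding poly_gamma_expansion_eq[OF assms(1) z] yeq[symmetric] y by simp
    then have "z \<in> \<real>" using h by (simp add: real_rooted_def)
    then show "y \<in> \<real>" unfolding yeq by simp
  qed
next
  assume f: "real_rooted f"
  show "real_rooted (gamma_expansion d f)"
    unfolding real_rooted_def
  proof (intro allI impI)
    fix z :: complex assume z: "poly (map_poly of_real (gamma_expansion d f)) z = 0"
    show "z \<in> \<real>"
    \<comment> \<open>The substitution has a pole at -1, but -1 is real anyway.\<close>
    proof (cases "z = -1")
      case False
      define y where "y = 4 * z / (z + 1)\<^sup>2"
      have z1: "z + 1 \<noteq> 0" using False by (simp add: add_eq_0_iff2)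
      then have fy: "poly (map_poly of_real f) y = 0"
        using z unfolding poly_gamma_expansion_eq[OF assms(1) False] y_def by simp
      then have "y \<in> \<real>" using f by (simp add: real_rooted_def)
      then obtain r where r: "y = of_real r" by (elim Reals_cases)
      have "complex_of_real (\<Sum>k\<le>d div 2. coeff f k * r ^ k) = 0"
        using fy unfolding poly_map_poly_of_real_altdef[OF assms(1)] r by simp
      then have "(\<Sum>k\<le>d div 2. coeff f k * r ^ k) = 0" by (simp only: of_real_eq_0_iff)
      \<comment> \<open>With nonnegative coefficients, the positive constant term alone excludes a
        root at any nonnegative real.\<close>
      moreover have "coeff f 0 * r ^ 0 \<le> (\<Sum>k\<le>d div 2. coeff f k * r ^ k)" if "0 \<le> r"
        using assms(2) that by (intro member_le_sum) auto
      ultimately have "r < 0" using assms(2)[of 0] assms(3) by force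
      define b where "b = 1 - 2 / r"
      have "b > 1" using \<open>r < 0\<close> by (simp add: b_def divide_less_0_iff)
      then have b1: "b\<^sup>2 - 1 > 0" by (simp add: one_less_power)
      have "b * r = r - 2" using \<open>r < 0\<close> by (simp add: b_def left_diff_distrib)
      then have br: "of_real b * y = y - 2" unfolding r by (metis of_real_diff of_real_mult of_real_numeral)
      have "y * (z + 1)\<^sup>2 = 4 * z" using z1 by (simp add: y_def)
      then have "y * ((z + of_real b)\<^sup>2 - (of_real b)\<^sup>2 + 1) = 0" using br by algebra
      moreover have "y \<noteq> 0" using r \<open>r < 0\<close> by simp
      ultimately have "(z + of_real b)\<^sup>2 - (of_real b)\<^sup>2 + 1 = 0" by simp
      then have "(z + of_real b)\<^sup>2 = (of_real b)\<^sup>2 - 1" by algebra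
      then have "(z + of_real b)\<^sup>2 = of_real (b\<^sup>2 - 1)" by simp
      also have "\<dots> = (of_real (sqrt (b\<^sup>2 - 1)))\<^sup>2"
        using b1 by (simp flip: of_real_power)
      finally have "z + of_real b = of_real (sqrt (b\<^sup>2 - 1)) \<or> z + of_real b = - of_real (sqrt (b\<^sup>2 - 1))"
        by (simp only: power2_eq_iff)
      then have "z = of_real (sqrt (b\<^sup>2 - 1) - b) \<or> z = of_real (- sqrt (b\<^sup>2 - 1) - b)"
        by (auto simp: algebra_simps)
      then show ?thesis by (metis Reals_of_real)
    qed simp
  qed
qed

section \<open>Left peak polynomials and the conclusion\<close>

lemma left_peak_poly_properties:
  fixes R :: "('n::{finite,linorder}) rel"
  assumes "naturally_labeled R"
  shows "degree (left_peak_poly R) \<le> CARD('n) div 2"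
    and "0 \<le> coeff (left_peak_poly R) k"
    and "0 < coeff (left_peak_poly R) 0"
    and "gamma_expansion CARD('n) (left_peak_poly R) =
      (\<Sum>\<pi>\<in>linear_extensions R. gamma_basis CARD('n) (left_peaks \<pi>))"
proof -
  have fin: "finite (linear_extensions R)"
    unfolding linear_extensions_def by (rule finite_subset[OF Collect_restrict]) simp
  have lp: "2 * left_peaks \<pi> \<le> CARD('n)" if "\<pi> \<in> linear_extensions R" for \<pi>
    using even_gf_left_peaks(1)[OF length_linear_extension(1,2)[OF that]] length_linear_extension(3)[OF that]
    by simp
  show "degree (left_peak_poly R) \<le> CARD('n) div 2"
    unfolding left_peak_poly_def
  proof (rule degree_sum_le[OF fin])
    fix \<pi> assume "\<pi> \<in> linear_extensions R"
    then show "degree (monom (1 :: real) (left_peaks \<pi>)) \<le> CARD('n) div 2"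
      using lp[of \<pi>] by (simp add: degree_monom_eq)
  qed
  have c: "coeff (left_peak_poly R) k = (\<Sum>\<pi>\<in>linear_extensions R. if left_peaks \<pi> = k then 1 else 0)" for k
    unfolding left_peak_poly_def coeff_sum by simp
  show "0 \<le> coeff (left_peak_poly R) k"
    unfolding c by (intro sum_nonneg) simp
  \<comment> \<open>By natural labeling the increasing list is a linear extension; it has no left
    peak, so the constant term is positive.\<close>
  let ?id = "sorted_list_of_set (UNIV :: 'n set)"
  have sorted: "?id ! i < ?id ! j" if "i < j" "j < length ?id" for i j
    using that strict_sorted_list_of_set[of "UNIV :: 'n set"] by (simp add: sorted_wrt_iff_nth_less)
  have "?id \<in> linear_extensions R"
    unfolding linear_extensions_def
  proof (intro CollectI conjI allI impI)
    show "?id \<in> permutations_of_set UNIV" by (simp add: permutations_of_set_def)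
    fix a b assume ab: "a < length ?id \<and> b < length ?id \<and> (?id ! a, ?id ! b) \<in> R \<and> ?id ! a \<noteq> ?id ! b"
    then have "?id ! a < ?id ! b" using assms unfolding naturally_labeled_def by blast
    then show "a < b" using sorted[of b a] ab by (metis linorder_neqE_nat order_less_asym)
  qed
  moreover have "left_peaks ?id = 0"
  proof -
    have "\<not> ?id ! (i + 1) < ?id ! i" if "i + 1 < length ?id" for i
      using sorted[of i "i + 1"] that by (simp add: order_less_imp_not_less)
    then show ?thesis unfolding left_peaks_def by (simp add: card_eq_0_iff)
  qed
  ultimately have "(1 :: real) \<le> (\<Sum>\<pi>\<in>linear_extensions R. if left_peaks \<pi> = 0 then 1 else 0)"
    using member_le_sum[of ?id "linear_extensions R" "\<lambda>\<pi>. if left_peaks \<pi> = 0 then 1 else 0 :: real"] fin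
    by simp
  then show "0 < coeff (left_peak_poly R) 0" unfolding c by simp
  show "gamma_expansion CARD('n) (left_peak_poly R) =
      (\<Sum>\<pi>\<in>linear_extensions R. gamma_basis CARD('n) (left_peaks \<pi>))"
    unfolding left_peak_poly_def gamma_expansion_sum
    using lp by (intro sum.cong refl gamma_expansion_monom)
qed

text \<open>The choice of natural relabelings is arbitrary. The rational substitution is stated
  pointwise away from its pole, which determines the polynomial since infinitely many points
  remain.\<close>

theorem theorem5p3:
  fixes P Q :: "('n::{finite,linorder}) rel"
    and R :: "real ^ 'n::{finite,linorder} \<Rightarrow> 'n rel"
    and f :: "real poly"
  assumes "partial_order_on UNIV P" and "partial_order_on UNIV Q"
    and "\<And>\<epsilon>. \<epsilon> \<in> sign_vectors \<Longrightarrow> relabeling_of (sign_poset P Q \<epsilon>) (R \<epsilon>)"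
    and "\<And>\<epsilon>. \<epsilon> \<in> sign_vectors \<Longrightarrow> naturally_labeled (R \<epsilon>)"
    and "f = smult (1 / 2 ^ CARD('n)) (\<Sum>\<epsilon>\<in>sign_vectors. left_peak_poly (R \<epsilon>))"
  shows "hstar (twinned_chain_polytope P Q) =
           smult (1 / 2 ^ CARD('n)) (\<Sum>\<epsilon>\<in>sign_vectors. hstar (enriched_chain_polytope (R \<epsilon>)))
       \<and> (\<forall>x. x \<noteq> -1 \<longrightarrow>
            poly (hstar (twinned_chain_polytope P Q)) x =
              (x + 1) ^ CARD('n) * poly f (4 * x / (x + 1)\<^sup>2))
       \<and> gamma_positive (hstar (twinned_chain_polytope P Q))
       \<and> (real_rooted (hstar (twinned_chain_polytope P Q)) \<longleftrightarrow> real_rooted f)"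
proof -
  let ?d = "CARD('n)"
  let ?\<Gamma> = "gamma_expansion ?d"
  note po = partial_order_on_sign_poset[OF assms(1,2)]
  have enr: "fps_of_poly (?\<Gamma> (left_peak_poly (R \<epsilon>))) =
      ehrhart_series (enriched_chain_polytope (R \<epsilon>)) * (1 - fps_X) ^ (?d + 1)"
    if "\<epsilon> \<in> sign_vectors" for \<epsilon>
    using fps_of_poly_hstar_enriched[OF partial_order_relabeling[OF po assms(3)[OF that]] assms(4)[OF that]]
    unfolding left_peak_poly_properties(4)[OF assms(4)[OF that]]
      ehrhart_series_enriched[OF partial_order_relabeling[OF po assms(3)[OF that]]] .
  have \<Gamma>f: "?\<Gamma> f = smult (1 / 2 ^ ?d) (\<Sum>\<epsilon>\<in>sign_vectors. ?\<Gamma> (left_peak_poly (R \<epsilon>)))"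
    unfolding assms(5) gamma_expansion_smult gamma_expansion_sum ..
  \<comment> \<open>The averaging formula concerns the sign posets, whereas peaks are counted for
    their natural relabelings; relabeling permutes coordinates and keeps the Ehrhart series.\<close>
  have "ehrhart_series (twinned_chain_polytope P Q) * (1 - fps_X) ^ (?d + 1) =
      fps_const (1 / 2 ^ ?d) *
        (\<Sum>\<epsilon>\<in>sign_vectors. ehrhart_series (enriched_chain_polytope (sign_poset P Q \<epsilon>)) * (1 - fps_X) ^ (?d + 1))"
    unfolding ehrhart_series_twinned[OF assms(1,2)] by (simp only: sum_distrib_right mult.assoc)
  also have "\<dots> = fps_of_poly (?\<Gamma> f)"
    unfolding \<Gamma>f fps_of_poly_smult fps_of_poly_sum
    by (intro arg_cong2[where f = "(*)"] refl sum.cong) (simp add: enr ehrhart_series_relabeling[OF po assms(3)])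
  finally have tw: "hstar (twinned_chain_polytope P Q) = ?\<Gamma> f"
    by (intro hstar_eqI) simp
  have "hstar (enriched_chain_polytope (R \<epsilon>)) = ?\<Gamma> (left_peak_poly (R \<epsilon>))" if "\<epsilon> \<in> sign_vectors" for \<epsilon>
    by (rule hstar_eqI[OF enr[OF that]])
  then have 1: "hstar (twinned_chain_polytope P Q) =
      smult (1 / 2 ^ ?d) (\<Sum>\<epsilon>\<in>sign_vectors. hstar (enriched_chain_polytope (R \<epsilon>)))"
    unfolding tw \<Gamma>f by simp
  have deg: "degree f \<le> ?d div 2"
    unfolding assms(5) using left_peak_poly_properties(1)[OF assms(4)] finite_sign_vectors
    by (intro order_trans[OF degree_smult_le] degree_sum_le)
  have nonneg: "0 \<le> coeff f k" for k
    unfolding assms(5) coeff_smult coeff_sum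
    by (intro mult_nonneg_nonneg sum_nonneg left_peak_poly_properties(2) assms(4)) simp_all
  have "card (sign_vectors :: (real, 'n) vec set) \<noteq> 0" by (simp add: card_sign_vectors)
  then have "sign_vectors \<noteq> ({} :: (real, 'n) vec set)" by force
  then have "0 < (\<Sum>\<epsilon>\<in>sign_vectors. coeff (left_peak_poly (R \<epsilon>)) 0)"
    by (intro sum_pos finite_sign_vectors left_peak_poly_properties(3) assms(4))
  then have f0: "coeff f 0 \<noteq> 0"
    unfolding assms(5) coeff_smult coeff_sum by simp
  have "poly (?\<Gamma> f) x = (x + 1) ^ ?d * poly f (4 * x / (x + 1)\<^sup>2)" if "x \<noteq> -1" for x
    using poly_gamma_expansion_eq[OF deg that] by (simp add: map_poly_of_real_id)
  then show ?thesis
    using 1 gamma_positive_gamma_expansion[OF nonneg f0] real_rooted_gamma_expansion[OF deg nonneg f0]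
    unfolding tw by blast
qed

end
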